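(* Fix $\Phi=\Phi_{upwind}$. Let $(r,\eta)\in AC(\mathbb{R}^+,L^\infty_\mu(K))\times AC(\mathbb{R}^+,C_b(D_K))$ be a solution of the Euler Co-NCL system with initial datum $(r_0,\eta_0)$ and with a pointwise monotonic velocity field $V:\mathbb{R}^+\times L^\infty_\mu(K)\to\mathcal{V}^{\mathrm{as}}(D_K)$ which is continuous in time and of the form $$V(r_t(x),r_t(x'))=\alpha(r_t(x))-\alpha(r_t(x')),$$ where $\alpha\in C^1_b(\mathbb{R})$ and for every compact $\Omega\subset\mathbb{R}$ there is $c>0$ with $\alpha'>c$ on $\Omega$. Assume also that there are constants $C_V,L_V>0$ with $|V_t(g(x),g(x'))|\le C_V$ and $|V_t(g(x),g(x'))-V_t(\tilde g(x),\tilde g(x'))|\le L_V\|g-\tilde g\|_{L^\infty_\mu(K)}$ for all $t\ge0$, $(x,x')\in D_K$, $g,\tilde g\in L^\infty_\mu(K)$. Let $\omega:\mathbb{R}^+\times L^\infty_\mu(K)\times D_K\to\mathbb{R}$ be such that: $(x,y)\mapsto\omega_t[r](x,y)$ is continuous and symmetric on $D_K$; $t\mapsto\omega_t$ is in $L^1([0,T])$ for every $T>0$; $|\omega_t[f](x,y)-\omega_t[g](x,y)|\le L_\omega\|f-g\|_{L^\infty_\mu(K)}$ and $|\omega_t[f](x,y)|\le\tilde C_\omega$ for all $t\ge0$, $(x,y)\in D_K$, $f,g\in L^\infty_\mu(K)$, with constants $L_\omega\ge0$, $\tilde C_\omega>0$; and $\inf_{t\ge0}\inf_{(x,x')\in D_K}\inf_{r\in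 L^\infty_\mu(K)\setminus\{0\}}\omega_t[r](x,x')>0$. Assume $r_0\ge0$, $\int_K r_0\,d\mu=M$, and $\eta_0\in C_b(D_K)$ is positive and symmetric. Then, for $\mu$-a.e. $x\in\mathbb{R}^d$, $$\lim_{t\to\infty}r_t(x)=\frac{M}{\mu(K)} .$$
   Context: $\mu$ is a Borel probability measure on $\mathbb{R}^d$ with compact support $K=\operatorname{supp}\mu$. $D_K:=\{(x,y)\in K\times K:x\ne y\}$; $C_b(D_K)$ is the space of bounded continuous functions with the supremum norm; $\mathcal{V}^{\mathrm{as}}(D_K):=\{v:D_K\to\mathbb{R}:v(x,y)=-v(y,x)\}$; symmetric means $h(x,y)=h(y,x)$. $\mathbb{R}^+=[0,\infty)$. $\Phi_{upwind}(a,b;w)=a\,w_+-b\,w_-$ with $w_\pm=\max\{\pm w,0\}$. A curve is in $AC(\mathbb{R}^+,S)$ if it is absolutely continuous on $[0,T]$ with values in $S$ for each $T>0$. A velocity is pointwise if $V_t[r](x,x')=V_t(r_t(x),r_t(x'))$. A pointwise velocity is monotonic if for $r\in L^\infty_\mu$, $t\ge0$ and $\mu$-a.e. points $x,y,x'$ (writing $V^\pm=\max\{\pm V,0\}$): $r(x)>r(y)$ implies $V_t^+(r(x),r(x'))\ge V_t^+(r(y),r(x'))$; $r(x)<r(y)$ implies $V_t^-(r(x),r(x'))\ge V_t^-(r(y),r(x'))$; $r(x)=r(y)$ implies $V_t(r(x),r(x'))=V_t(r(y),r(x'))$; $r(x)=r(x')$ implies $V_t(r(x),r(x'))=0$. $(r,\eta)$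 solves the Euler Co-NCL system with initial datum $(r_0,\eta_0)\in L^\infty_\mu(K)\times C_b(D_K)$ if for $\mu$-a.e. $x\in K$, all $t\ge0$ and all $(x,y)\in D_K$, $$r_t(x)=r_0(x)-\int_0^t\int_{K\setminus\{x\}}\Phi(r_s(x),r_s(y);V_s(r_s(x),r_s(y)))\,\eta_s(x,y)\,d\mu(y)\,ds,$$ $$\eta_t(x,y)=\eta_0(x,y)+\int_0^t(\omega_s[r](x,y)-\eta_s(x,y))\,ds,$$ with locally time-integrable integrands, where $\omega_s[r]$ means $\omega_s[r_s]$. *)

theory Defs
  imports "HOL-Probability.Probability"
begin

definition measure_supp :: "'a::topological_space measure \<Rightarrow> 'a set" where
  "measure_supp \<mu> = {x. \<forall>U. open U \<and> x \<in> U \<longrightarrow> 0 < emeasure \<mu> U}"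

definition offdiag :: "'a set \<Rightarrow> ('a \<times> 'a) set" where
  "offdiag K = {(x, y). x \<in> K \<and> y \<in> K \<and> x \<noteq> y}"

(* The elements of L^infinity are represented by functions on the whole space; two of them
   are the same element iff they agree almost everywhere. A measure that is carried by its
   support K does not see their values off K, so this is L^infinity over K. *)
definition Linf :: "'a measure \<Rightarrow> ('a \<Rightarrow> real) set" where
  "Linf \<mu> = {f \<in> borel_measurable \<mu>. esssup \<mu> (\<lambda>x. ereal \<bar>f x\<bar>) < \<infinity>}"

definition Linf_norm :: "'a measure \<Rightarrow> ('a \<Rightarrow> real) \<Rightarrow> real" where
  "Linf_norm \<mu> f = real_of_ereal (esssup \<mu> (\<lambda>x. ereal \<bar>f x\<bar>))"

definition Cb :: "'z::topological_space set \<Rightarrow> ('z \<Rightarrow> real) set" where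
  "Cb D = {f. continuous_on D f \<and> bounded (f ` D)}"

(* Inserting 0 only matters for empty D, where Sup {} is unspecified for reals. *)
definition sup_norm_on :: "'z set \<Rightarrow> ('z \<Rightarrow> real) \<Rightarrow> real" where
  "sup_norm_on D f = Sup (insert 0 ((\<lambda>z. \<bar>f z\<bar>) ` D))"

definition symmetric_on :: "('a \<times> 'a) set \<Rightarrow> ('a \<times> 'a \<Rightarrow> real) \<Rightarrow> bool" where
  "symmetric_on D h \<longleftrightarrow> (\<forall>(x, y)\<in>D. h (x, y) = h (y, x))"

definition antisymmetric_on :: "('a \<times> 'a) set \<Rightarrow> ('a \<times> 'a \<Rightarrow> real) \<Rightarrow> bool" where
  "antisymmetric_on D h \<longleftrightarrow> (\<forall>(x, y)\<in>D. h (x, y) = - h (y, x))"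

(* N is the norm (a seminorm on representatives) of the target space S. *)
definition abs_cont_curve ::
    "('u \<Rightarrow> real) \<Rightarrow> real \<Rightarrow> (real \<Rightarrow> 'u::minus) \<Rightarrow> bool" where
  "abs_cont_curve N T u \<longleftrightarrow>
     (\<forall>\<epsilon>>0. \<exists>\<delta>>0. \<forall>(n::nat) a b.
        (\<forall>i<n. 0 \<le> a i \<and> a i \<le> b i \<and> b i \<le> T) \<and>
        disjoint_family_on (\<lambda>i. {a i<..<b i}) {..<n} \<and>
        (\<Sum>i<n. b i - a i) < \<delta>
        \<longrightarrow> (\<Sum>i<n. N (u (b i) - u (a i))) < \<epsilon>)"

definition AC :: "('u \<Rightarrow> real) \<Rightarrow> 'u set \<Rightarrow> (real \<Rightarrow> 'u::minus) set" where
  "AC N S = {u. (\<forall>t\<ge>0. u t \<in> S) \<and> (\<forall>T>0. abs_cont_curve N T u)}"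

definition C1b :: "(real \<Rightarrow> real) set" where
  "C1b = {f. (\<forall>x. f differentiable at x) \<and> continuous_on UNIV (deriv f) \<and>
             bounded (range f) \<and> bounded (range (deriv f))}"

definition Phi_upwind :: "real \<Rightarrow> real \<Rightarrow> real \<Rightarrow> real" where
  "Phi_upwind a b w = a * max w 0 - b * max (- w) 0"

(* The second conjunct says that V t depends only on the class of g in L^infinity. *)
definition velocity_field ::
    "'a measure \<Rightarrow> 'a set \<Rightarrow> (real \<Rightarrow> ('a \<Rightarrow> real) \<Rightarrow> 'a \<times> 'a \<Rightarrow> real) \<Rightarrow> bool" where
  "velocity_field \<mu> K V \<longleftrightarrow>
     (\<forall>t\<ge>0. \<forall>g\<in>Linf \<mu>. antisymmetric_on (offdiag K) (V t g)) \<and>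
     (\<forall>t\<ge>0. \<forall>g\<in>Linf \<mu>. \<forall>h\<in>Linf \<mu>. (AE x in \<mu>. g x = h x) \<longrightarrow>
        (\<forall>z\<in>offdiag K. V t g z = V t h z))"

definition time_continuous_velocity ::
    "'a measure \<Rightarrow> 'a set \<Rightarrow> (real \<Rightarrow> ('a \<Rightarrow> real) \<Rightarrow> 'a \<times> 'a \<Rightarrow> real) \<Rightarrow> bool" where
  "time_continuous_velocity \<mu> K V \<longleftrightarrow>
     (\<forall>g\<in>Linf \<mu>. \<forall>z\<in>offdiag K. continuous_on {0..} (\<lambda>t. V t g z))"

(* A pointwise velocity field V is given by a real function v, which the informal notation
   also calls V:  V_t[g](x,x') = v_t(g(x),g(x')). As g is only defined up to null sets, a
   relation involving values g(x) is required for almost all points; an everywhere version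
   over all representatives would be contradictory or would force v to be trivial. *)
definition pointwise_velocity ::
    "'a measure \<Rightarrow> 'a set \<Rightarrow> (real \<Rightarrow> ('a \<Rightarrow> real) \<Rightarrow> 'a \<times> 'a \<Rightarrow> real) \<Rightarrow>
     (real \<Rightarrow> real \<Rightarrow> real \<Rightarrow> real) \<Rightarrow> bool" where
  "pointwise_velocity \<mu> K V v \<longleftrightarrow>
     (\<forall>t\<ge>0. \<forall>g\<in>Linf \<mu>. AE x in \<mu>. AE x' in \<mu>.
        (x, x') \<in> offdiag K \<longrightarrow> V t g (x, x') = v t (g x) (g x'))"

definition monotonic_velocity :: "'a measure \<Rightarrow> (real \<Rightarrow> real \<Rightarrow> real \<Rightarrow> real) \<Rightarrow> bool" where
  "monotonic_velocity \<mu> v \<longleftrightarrow>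
     (\<forall>r\<in>Linf \<mu>. \<forall>t\<ge>0. AE x in \<mu>. AE y in \<mu>. AE x' in \<mu>.
        (r x > r y \<longrightarrow> max (v t (r x) (r x')) 0 \<ge> max (v t (r y) (r x')) 0) \<and>
        (r x < r y \<longrightarrow> max (- v t (r x) (r x')) 0 \<ge> max (- v t (r y) (r x')) 0) \<and>
        (r x = r y \<longrightarrow> v t (r x) (r x') = v t (r y) (r x')) \<and>
        (r x = r x' \<longrightarrow> v t (r x) (r x') = 0))"

(* Integrals in time are Lebesgue integrals. The equation for r is for almost every x and then
   all t, so it singles out the pointwise representative of the curve r. *)
definition euler_co_ncl_solution ::
    "'a::euclidean_space measure \<Rightarrow> 'a set \<Rightarrow> (real \<Rightarrow> real \<Rightarrow> real \<Rightarrow> real) \<Rightarrow>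
     (real \<Rightarrow> real \<Rightarrow> real \<Rightarrow> real) \<Rightarrow>
     (real \<Rightarrow> ('a \<Rightarrow> real) \<Rightarrow> 'a \<times> 'a \<Rightarrow> real) \<Rightarrow>
     ('a \<Rightarrow> real) \<Rightarrow> ('a \<times> 'a \<Rightarrow> real) \<Rightarrow>
     (real \<Rightarrow> 'a \<Rightarrow> real) \<Rightarrow> (real \<Rightarrow> 'a \<times> 'a \<Rightarrow> real) \<Rightarrow> bool" where
  "euler_co_ncl_solution \<mu> K \<Phi> v \<omega> r0 \<eta>0 r \<eta> \<longleftrightarrow>
     r0 \<in> Linf \<mu> \<and> \<eta>0 \<in> Cb (offdiag K) \<and>
     (AE x in \<mu>. x \<in> K \<longrightarrow>
        (let flux = (\<lambda>s y. \<Phi> (r s x) (r s y) (v s (r s x) (r s y)) * \<eta> s (x, y));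
             outflow = (\<lambda>s. LINT y:K - {x}|\<mu>. flux s y)
         in (\<forall>s\<ge>0. set_integrable \<mu> (K - {x}) (flux s)) \<and>
            (\<forall>t\<ge>0. outflow absolutely_integrable_on {0..t} \<and>
                    r t x = r0 x - (LINT s:{0..t}|lebesgue. outflow s)))) \<and>
     (\<forall>z\<in>offdiag K. \<forall>t\<ge>0.
        (\<lambda>s. \<omega> s (r s) z - \<eta> s z) absolutely_integrable_on {0..t} \<and>
        \<eta> t z = \<eta>0 z + (LINT s:{0..t}|lebesgue. \<omega> s (r s) z - \<eta> s z))"

end

theory Submission
  imports Defs "HOL-Real_Asymp.Real_Asymp"
begin

text \<open>Antisymmetry of the flux conserves the mass. If \<open>M = 0\<close>, Gronwall's lemma gives \<open>r = 0\<close>.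
  If \<open>M > 0\<close>, then \<open>r\<^sub>t\<close> never vanishes, so \<open>\<omega>\<close> is bounded below along the solution and
  \<open>0 < h \<le> \<eta>\<^sub>t \<le> H\<close> for \<open>t \<ge> 1\<close>; moreover \<open>r\<close> stays in \<open>[0, R]\<close> with \<open>R\<close> the norm of \<open>r\<^sub>0\<close>.
  Let \<open>c\<close> and \<open>L\<close> bound the slope of \<open>\<alpha>\<close> on \<open>[0, R]\<close> from below and above, and let \<open>D(t)\<close> be the
  supremum of \<open>\<bar>r\<^sub>t - M\<bar>\<close>. With \<open>k = h c M\<close> and \<open>B = R L H\<close> every value \<open>y = r\<^sub>t(x) - M\<close> satisfies the
  linear inequality \<open>\<bar>y' + (k + B) y\<bar> \<le> B D(t)\<close>, whence \<open>D(t) \<le> D(1) exp(- k (t - 1))\<close> by Gronwall's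
  lemma. No derivative of a supremum is needed.\<close>

section \<open>Barrier and Gronwall arguments\<close>

lemma nonincreasing_within:
  fixes f :: "real \<Rightarrow> real"
  assumes "a \<le> b"
    and "\<And>s. s \<in> {a..b} \<Longrightarrow> (f has_real_derivative f' s) (at s within {a..b})"
    and "\<And>s. s \<in> {a..b} \<Longrightarrow> f' s \<le> 0"
  shows "f b \<le> f a"
proof -
  obtain s where "s \<in> {a..b}" "f b - f a = (*) (f' s) (b - a)"
    using mvt_very_simple[OF assms(1), of f "\<lambda>s. (*) (f' s)"] assms(2)
    unfolding has_field_derivative_def by auto
  then show ?thesis
    using assms(1) assms(3)[of s] mult_nonpos_nonneg[of "f' s" "b - a"] by simp
qed

text \<open>If \<open>d t > 0\<close>, let \<open>s\<close> be the last time with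
  \<open>d s \<le> 0\<close>. There \<open>d\<close> vanishes by the intermediate value theorem and
  stays nonnegative afterwards, so \<open>dec\<close> forces \<open>d t \<le> 0\<close>. The
  hypothesis compares increments instead of derivatives because the weights satisfy only an integral
  equation.\<close>

lemma nonpositive_barrier:
  fixes d :: "real \<Rightarrow> real"
  assumes cont: "continuous_on {a..t} d" and init: "d a \<le> 0" and "a \<le> t"
    and dec: "\<And>s. a \<le> s \<Longrightarrow> s < t \<Longrightarrow> (\<And>\<tau>. \<tau> \<in> {s..t} \<Longrightarrow> 0 \<le> d \<tau>) \<Longrightarrow> d t \<le> d s"
  shows "d t \<le> 0"
proof (rule ccontr)
  assume "\<not> d t \<le> 0"
  define Z where "Z = {s \<in> {a..t}. d s \<le> 0}"
  have "closed Z"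
    unfolding Z_def using cont by (intro continuous_on_closed_Collect_le) auto
  then have "compact Z"
    by (auto simp: Z_def compact_eq_bounded_closed intro: bounded_subset[of "{a..t}"])
  moreover have "a \<in> Z"
    using init \<open>a \<le> t\<close> by (simp add: Z_def)
  ultimately obtain s where s: "s \<in> Z" "\<And>\<tau>. \<tau> \<in> Z \<Longrightarrow> \<tau> \<le> s"
    using compact_attains_sup[of Z] by auto
  with \<open>\<not> d t \<le> 0\<close> have "a \<le> s" "s < t" "d s \<le> 0"
    by (auto simp: Z_def less_le)
  moreover have "continuous_on {s..t} d"
    using cont \<open>a \<le> s\<close> by (auto intro: continuous_on_subset)
  ultimately obtain s' where "s' \<in> {s..t}" "d s' = 0"
    using IVT'[of d s 0 t] \<open>\<not> d t \<le> 0\<close> by auto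
  then have "s' \<in> Z"
    using \<open>a \<le> s\<close> by (simp add: Z_def)
  then have "d s = 0"
    using s(2)[of s'] \<open>s' \<in> {s..t}\<close> \<open>d s' = 0\<close> by (metis atLeastAtMost_iff order_antisym)
  have "0 \<le> d \<tau>" if "\<tau> \<in> {s..t}" for \<tau>
    using s(2)[of \<tau>] that \<open>a \<le> s\<close> \<open>d s = 0\<close> by (force simp: Z_def)
  then show False
    using dec[of s] \<open>a \<le> s\<close> \<open>s < t\<close> \<open>d s = 0\<close> \<open>\<not> d t \<le> 0\<close> by auto
qed

text \<open>The supremum \<open>N\<close> of the positive parts need not be differentiable, but it
  is continuous, and its weighted integral \<open>W\<close> dominates every
  \<open>exp (A * s) * u j s\<close>. The ordinary Gronwall argument then applies to
  \<open>W\<close>. In \<open>step\<close> an arbitrary bound \<open>P\<close> stands for the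
  supremum, so applications never have to form it.\<close>

lemma sup_gronwall:
  fixes u g :: "'i \<Rightarrow> real \<Rightarrow> real"
  assumes der: "\<And>i s. i \<in> I \<Longrightarrow> s \<in> {a..b} \<Longrightarrow>
      (u i has_real_derivative g i s) (at s within {a..b})"
    and u_bound: "\<And>i s. i \<in> I \<Longrightarrow> s \<in> {a..b} \<Longrightarrow> u i s \<le> R"
    and g_bound: "\<And>i s. i \<in> I \<Longrightarrow> s \<in> {a..b} \<Longrightarrow> \<bar>g i s\<bar> \<le> C"
    and step: "\<And>i s P. i \<in> I \<Longrightarrow> s \<in> {a..b} \<Longrightarrow> 0 \<le> P \<Longrightarrow> (\<And>j. j \<in> I \<Longrightarrow> u j s \<le> P) \<Longrightarrow>
      g i s + A * u i s \<le> B * P"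
    and init: "\<And>i. i \<in> I \<Longrightarrow> u i a \<le> P0" and "0 \<le> P0" "0 \<le> B"
    and "i \<in> I" "t \<in> {a..b}"
  shows "u i t \<le> P0 * exp ((B - A) * (t - a))"
proof -
  define N where "N s = (SUP i\<in>I. max 0 (u i s))" for s
  have bdd: "bdd_above ((\<lambda>i. max 0 (u i s)) ` I)" if "s \<in> {a..b}" for s
    using u_bound[OF _ that] by (intro bdd_aboveI2[where M="max 0 R"]) (force simp: max_def)
  have uN: "max 0 (u j s) \<le> N s" if "j \<in> I" "s \<in> {a..b}" for j s
    unfolding N_def using that by (intro cSUP_upper bdd)
  have N0: "0 \<le> N s" if "s \<in> {a..b}" for s
    using uN[OF \<open>i \<in> I\<close> that] by simp
  \<comment> \<open>The common derivative bound \<open>C\<close> gives all members the same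
    Lipschitz constant, and the supremum inherits it.\<close>
  have lip: "\<bar>u j s - u j s'\<bar> \<le> C * \<bar>s - s'\<bar>" if "j \<in> I" "s \<in> {a..b}" "s' \<in> {a..b}" for j s s'
    using field_differentiable_bound[of "{a..b}" "u j" "g j" C s s'] der g_bound that by simp
  have N_le: "N s \<le> N s' + C * dist s s'" if "s \<in> {a..b}" "s' \<in> {a..b}" for s s'
    unfolding N_def[of s]
  proof (rule cSUP_least)
    fix j assume "j \<in> I"
    then show "max 0 (u j s) \<le> N s' + C * dist s s'"
      using uN[of j s'] lip[of j s s'] that by (auto simp: dist_real_def)
  qed (use \<open>i \<in> I\<close> in auto)
  have "0 \<le> C"
    using g_bound[OF \<open>i \<in> I\<close> \<open>t \<in> {a..b}\<close>] by linarith
  have "C-lipschitz_on {a..b} N"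
  proof (rule lipschitz_onI[OF _ \<open>0 \<le> C\<close>])
    fix s s' assume "s \<in> {a..b}" "s' \<in> {a..b}"
    then show "dist (N s) (N s') \<le> C * dist s s'"
      using N_le[of s s'] N_le[of s' s] by (auto simp: dist_real_def abs_le_iff abs_minus_commute)
  qed
  then have N_cont: "continuous_on {a..b} N"
    by (rule lipschitz_on_continuous_on)
  \<comment> \<open>By \<open>step\<close> with \<open>P = N s\<close>, the derivative of
    \<open>exp (A * s) * u j s\<close> is at most that of \<open>W\<close>, and \<open>W\<close>
    starts above it.\<close>
  define W where "W s = exp (A * a) * P0 + integral {a..s} (\<lambda>\<tau>. B * exp (A * \<tau>) * N \<tau>)" for s
  have W_der: "(W has_real_derivative B * exp (A * s) * N s) (at s within {a..b})"
    if "s \<in> {a..b}" for s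
  proof -
    have "continuous_on {a..b} (\<lambda>\<tau>. B * exp (A * \<tau>) * N \<tau>)"
      using N_cont by (intro continuous_intros)
    from integral_has_real_derivative[OF this that] show ?thesis
      unfolding W_def by (auto intro: derivative_eq_intros)
  qed
  have sub: "(f has_real_derivative D) (at \<tau> within {a..s})"
    if "(f has_real_derivative D) (at \<tau> within {a..b})" "s \<in> {a..b}" for f :: "real \<Rightarrow> real" and D s \<tau>
    using that by (auto intro: DERIV_subset)
  have uW: "exp (A * s) * u j s \<le> W s" if "j \<in> I" "s \<in> {a..b}" for j s
  proof -
    have "exp (A * s) * u j s - W s \<le> exp (A * a) * u j a - W a"
    proof (rule nonincreasing_within[where
          f = "\<lambda>\<tau>. exp (A * \<tau>) * u j \<tau> - W \<tau>" and f' = "\<lambda>\<tau>. exp (A * \<tau>) * (g j \<tau> + A * u j \<tau> - B * N \<tau>)"])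
      fix \<tau> assume \<tau>: "\<tau> \<in> {a..s}"
      then have \<tau>': "\<tau> \<in> {a..b}" using that by auto
      show "((\<lambda>\<tau>. exp (A * \<tau>) * u j \<tau> - W \<tau>) has_real_derivative
          exp (A * \<tau>) * (g j \<tau> + A * u j \<tau> - B * N \<tau>)) (at \<tau> within {a..s})"
        by (rule sub[OF _ that(2)])
          (auto intro!: derivative_eq_intros der[OF that(1) \<tau>'] W_der[OF \<tau>'] simp: algebra_simps)
      show "exp (A * \<tau>) * (g j \<tau> + A * u j \<tau> - B * N \<tau>) \<le> 0"
        using step[OF that(1) \<tau>' N0[OF \<tau>']] uN[OF _ \<tau>'] by (intro mult_nonneg_nonpos) auto
    qed (use that in auto)
    moreover have "exp (A * a) * u j a \<le> W a"
      using init[OF that(1)] by (simp add: W_def)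
    ultimately show ?thesis by simp
  qed
  \<comment> \<open>\<open>N\<close> contains positive parts, so \<open>W\<close> must dominate zero
    as well as the members of the family.\<close>
  have W0: "0 \<le> W s" if "s \<in> {a..b}" for s
  proof -
    have "continuous_on {a..s} (\<lambda>\<tau>. B * exp (A * \<tau>) * N \<tau>)"
      using that by (intro continuous_intros continuous_on_subset[OF N_cont]) auto
    then have "0 \<le> integral {a..s} (\<lambda>\<tau>. B * exp (A * \<tau>) * N \<tau>)"
      using N0 that \<open>0 \<le> B\<close> by (intro integral_nonneg integrable_continuous_real) auto
    then show ?thesis
      using \<open>0 \<le> P0\<close> by (simp add: W_def)
  qed
  have NW: "exp (A * s) * N s \<le> W s" if "s \<in> {a..b}" for s
  proof -
    have "N s \<le> exp (- (A * s)) * W s"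
      unfolding N_def
    proof (rule cSUP_least)
      fix j assume "j \<in> I"
      then show "max 0 (u j s) \<le> exp (- (A * s)) * W s"
        using uW[of j s] W0[of s] that by (auto simp: exp_minus field_simps)
    qed (use \<open>i \<in> I\<close> in auto)
    then show ?thesis by (simp add: exp_minus field_simps)
  qed
  \<comment> \<open>By \<open>NW\<close> the derivative of \<open>W\<close> is at most
    \<open>B * W\<close>.\<close>
  have "W t * exp (- (B * t)) \<le> W a * exp (- (B * a))"
  proof (rule nonincreasing_within[where
        f = "\<lambda>\<tau>. W \<tau> * exp (- (B * \<tau>))" and f' = "\<lambda>\<tau>. B * exp (- (B * \<tau>)) * (exp (A * \<tau>) * N \<tau> - W \<tau>)"])
    fix \<tau> assume "\<tau> \<in> {a..t}"
    then have \<tau>: "\<tau> \<in> {a..b}" using \<open>t \<in> {a..b}\<close> by auto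
    show "((\<lambda>\<tau>. W \<tau> * exp (- (B * \<tau>))) has_real_derivative
        B * exp (- (B * \<tau>)) * (exp (A * \<tau>) * N \<tau> - W \<tau>)) (at \<tau> within {a..t})"
      by (rule sub[OF _ \<open>t \<in> {a..b}\<close>])
        (auto intro!: derivative_eq_intros W_der[OF \<tau>] simp: algebra_simps)
    show "B * exp (- (B * \<tau>)) * (exp (A * \<tau>) * N \<tau> - W \<tau>) \<le> 0"
      using NW[OF \<tau>] \<open>0 \<le> B\<close> by (intro mult_nonneg_nonpos) auto
  qed (use \<open>t \<in> {a..b}\<close> in auto)
  then have "W t \<le> exp (A * a) * P0 * exp (B * t - B * a)"
    by (simp add: W_def exp_minus exp_diff field_simps)
  then have "u i t \<le> exp (- (A * t)) * (exp (A * a) * P0 * exp (B * t - B * a))"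
    using uW[OF \<open>i \<in> I\<close> \<open>t \<in> {a..b}\<close>] by (simp add: exp_minus field_simps)
  also have "\<dots> = P0 * (exp (- (A * t)) * exp (A * a) * exp (B * t - B * a))"
    by simp
  also have "\<dots> = P0 * exp ((B - A) * (t - a))"
    by (simp flip: exp_add add: algebra_simps)
  finally show ?thesis .
qed

section \<open>The upwind flux\<close>

lemma abs_Phi_upwind_le:
  assumes "\<bar>a\<bar> \<le> P" "\<bar>b\<bar> \<le> P"
  shows "\<bar>Phi_upwind a b w\<bar> \<le> P * \<bar>w\<bar>"
proof (cases "w \<ge> 0")
  case True
  then show ?thesis
    using assms(1) by (simp add: Phi_upwind_def abs_mult mult_right_mono)
next
  case False
  then show ?thesis
    using assms(2) by (simp add: Phi_upwind_def abs_mult mult_right_mono)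
qed

text \<open>With an antisymmetric velocity and a symmetric weight, the exchange between two points
  cancels; conservation of the mass rests on this.\<close>

lemma Phi_upwind_swap: "Phi_upwind b a (- w) = - Phi_upwind a b w"
  by (simp add: Phi_upwind_def)

lemma Phi_upwind_measurable [measurable (raw)]:
  assumes [measurable]: "f \<in> borel_measurable M" "g \<in> borel_measurable M" "h \<in> borel_measurable M"
  shows "(\<lambda>x. Phi_upwind (f x) (g x) (h x)) \<in> borel_measurable M"
  unfolding Phi_upwind_def by measurable

lemma Phi_upwind_continuous_on [continuous_intros]:
  assumes "continuous_on S f" "continuous_on S g" "continuous_on S h"
  shows "continuous_on S (\<lambda>x. Phi_upwind (f x) (g x) (h x))"
  unfolding Phi_upwind_def using assms by (intro continuous_intros)

text \<open>This prepares the nonnegativity of \<open>r\<close>, with \<open>P\<close> bounding the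
  negative parts. For \<open>w \<ge> 0\<close> the product is \<open>A * a\<close> minus
  \<open>(A - w * e) * a\<close>, and the second part costs at most \<open>A * P\<close>. For
  \<open>w < 0\<close> the flux costs at most \<open>A * P\<close>, and a further
  \<open>A * P\<close> compensates \<open>A * a\<close>.\<close>

lemma Phi_upwind_le_linear:
  assumes "0 \<le> e" "\<bar>w\<bar> * e \<le> A" "0 \<le> P" "- P \<le> a" "- P \<le> b"
  shows "Phi_upwind a b w * e \<le> A * a + 2 * A * P"
proof (cases "w \<ge> 0")
  case True
  have "0 \<le> w * e" "w * e \<le> A"
    using assms True by auto
  then have "(A - w * e) * (- a) \<le> (A - w * e) * P" "(A - w * e) * P \<le> A * P" "0 \<le> A * P"
    using assms by (intro mult_left_mono mult_right_mono mult_nonneg_nonneg; simp)+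
  then show ?thesis
    using True by (simp add: Phi_upwind_def algebra_simps)
next
  case False
  have "0 \<le> - w * e" "- w * e \<le> A"
    using assms False by (auto simp: mult_nonpos_nonneg)
  then have "(- w * e) * (- b) \<le> (- w * e) * P" "(- w * e) * P \<le> A * P" "A * (- P) \<le> A * a"
    using assms(3-5) by (intro mult_left_mono mult_right_mono; linarith)+
  then show ?thesis
    using False by (simp add: Phi_upwind_def algebra_simps)
qed

text \<open>In the next two bounds \<open>c\<close> and \<open>L\<close> are the bi-Lipschitz constants of \<open>\<alpha>\<close>,
  \<open>w = \<alpha> a - \<alpha> b\<close>, and \<open>e\<close> stands for the weight \<open>\<eta>\<close>.\<close>

lemma neg_Phi_upwind_le:
  assumes "0 \<le> a" "0 \<le> b" "b \<le> R" "a \<le> Q" "b \<le> Q" "0 \<le> h" "h \<le> e" "e \<le> H" "0 \<le> c" "0 \<le> L"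
    and ge: "b \<le> a \<Longrightarrow> c * (a - b) \<le> w" and le: "a \<le> b \<Longrightarrow> w \<le> 0 \<and> - w \<le> L * (b - a)"
    and "0 \<le> m" "m \<le> a"
  shows "- (Phi_upwind a b w * e) \<le> R * L * H * (Q - a) - h * c * m * (a - b)"
\<comment> \<open>In each case one of the two terms on the right controls the flux and the other has
  the favourable sign. The common bound is affine in \<open>b\<close>, so after integration only the
  mean of \<open>r\<close> remains. The free factor \<open>m\<close> allows the second term to be
  switched off.\<close>
proof (cases "b \<le> a")
  case True
  then have "0 \<le> w"
    using ge \<open>0 \<le> c\<close> by (meson diff_ge_0_iff_ge mult_nonneg_nonneg order_trans)
  have "m * (c * (a - b)) * h \<le> a * w * e"
    using assms True \<open>0 \<le> w\<close> by (intro mult_mono mult_nonneg_nonneg) auto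
  moreover have "0 \<le> R * L * H * (Q - a)"
    using assms by (intro mult_nonneg_nonneg) auto
  ultimately show ?thesis
    using \<open>0 \<le> w\<close> by (simp add: Phi_upwind_def algebra_simps)
next
  case False
  then have w: "w \<le> 0" "- w \<le> L * (b - a)" using le by auto
  have "b * (- w) * e \<le> R * (L * (b - a)) * H"
    using assms False w by (intro mult_mono mult_nonneg_nonneg) auto
  also have "\<dots> \<le> R * L * H * (Q - a)"
    using assms by (auto simp: mult_ac intro!: mult_left_mono)
  finally have "b * (- w) * e \<le> R * L * H * (Q - a)" .
  moreover have "h * c * m * (a - b) \<le> 0"
    using assms False by (intro mult_nonneg_nonpos mult_nonneg_nonneg) auto
  ultimately show ?thesis
    using w by (simp add: Phi_upwind_def)
qed

lemma Phi_upwind_le: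
  assumes "0 \<le> a" "0 \<le> b" "a \<le> R" "q \<le> a" "q \<le> b" "0 \<le> h" "h \<le> e" "e \<le> H" "0 \<le> c" "0 \<le> L"
    and ge: "b \<le> a \<Longrightarrow> 0 \<le> w \<and> w \<le> L * (a - b)" and le: "a \<le> b \<Longrightarrow> c * (b - a) \<le> - w"
  shows "Phi_upwind a b w * e \<le> R * L * H * (a - q) - h * c * b * (b - a)"
\<comment> \<open>The same splitting, but mass now flows in from the larger value \<open>b\<close>,
  so the second term carries the factor \<open>b\<close> and is quadratic in
  \<open>b\<close>.\<close>
proof (cases "a \<le> b")
  case True
  then have "0 \<le> - w"
    using le \<open>0 \<le> c\<close> by (meson diff_ge_0_iff_ge mult_nonneg_nonneg order_trans)
  have "b * (c * (b - a)) * h \<le> b * (- w) * e"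
    using assms True \<open>0 \<le> - w\<close> by (intro mult_mono mult_nonneg_nonneg) auto
  moreover have "0 \<le> R * L * H * (a - q)"
    using assms by (intro mult_nonneg_nonneg) auto
  ultimately show ?thesis
    using \<open>0 \<le> - w\<close> by (simp add: Phi_upwind_def algebra_simps)
next
  case False
  then have w: "0 \<le> w" "w \<le> L * (a - b)" using ge by auto
  have "a * w * e \<le> R * (L * (a - b)) * H"
    using assms False w by (intro mult_mono mult_nonneg_nonneg) auto
  also have "\<dots> \<le> R * L * H * (a - q)"
    using assms by (auto simp: mult_ac intro!: mult_left_mono)
  finally have "a * w * e \<le> R * L * H * (a - q)" .
  moreover have "h * c * b * (b - a) \<le> 0"
    using assms False by (intro mult_nonneg_nonpos mult_nonneg_nonneg) auto
  ultimately show ?thesis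
    using w by (simp add: Phi_upwind_def)
qed

section \<open>Null sets, essential suprema and continuity of the norm\<close>

text \<open>The complement of the support is covered by basic open sets of measure zero, and a
  countable basis has only countably many of them.\<close>

lemma AE_in_measure_supp:
  fixes \<mu> :: "'a::second_countable_topology measure"
  assumes "sets \<mu> = sets borel"
  shows "AE x in \<mu>. x \<in> measure_supp \<mu>"
proof -
  obtain B :: "'a set set" where B: "countable B" "topological_basis B"
    using ex_countable_basis by blast
  have "(\<Union>U\<in>{U \<in> B. emeasure \<mu> U = 0}. U) \<in> null_sets \<mu>"
    using B topological_basis_open[OF B(2)] assms
    by (intro null_sets_UN') (auto simp: null_sets_def)
  moreover have "{x \<in> space \<mu>. x \<notin> measure_supp \<mu>} \<subseteq> (\<Union>U\<in>{U \<in> B. emeasure \<mu> U = 0}. U)"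
  proof safe
    fix x assume "x \<notin> measure_supp \<mu>"
    then obtain U where U: "open U" "x \<in> U" "emeasure \<mu> U = 0"
      by (auto simp: measure_supp_def)
    then obtain W where W: "W \<in> B" "x \<in> W" "W \<subseteq> U"
      using B(2) by (metis topological_basisE)
    then have "emeasure \<mu> W \<le> emeasure \<mu> U"
      using assms U by (intro emeasure_mono) auto
    with U W show "x \<in> (\<Union>U\<in>{U \<in> B. emeasure \<mu> U = 0}. U)"
      by auto
  qed
  ultimately show ?thesis
    by (rule AE_I')
qed

text \<open>This turns almost sure inequalities at countably many times into one exceptional set for
  all times.\<close>

lemma continuous_on_le_of_Rats:
  fixes f g :: "real \<Rightarrow> real"
  assumes "continuous_on {a..} f" "continuous_on {a..} g"
    and le: "\<And>q. q \<in> \<rat> \<Longrightarrow> a \<le> q \<Longrightarrow> f q \<le> g q" and "a \<le> t"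
  shows "f t \<le> g t"
proof (rule ccontr)
  assume "\<not> f t \<le> g t"
  moreover have "continuous_on {a..} (\<lambda>s. f s - g s)"
    using assms by (intro continuous_intros)
  ultimately obtain d where "d > 0"
    and d: "\<And>s. s \<in> {a..} \<Longrightarrow> dist s t < d \<Longrightarrow> dist (f s - g s) (f t - g t) < f t - g t"
    using \<open>a \<le> t\<close> unfolding continuous_on_iff by (meson atLeast_iff diff_gt_0_iff_gt not_le)
  \<comment> \<open>The rational lies to the right of \<open>t\<close>, so it stays in the domain
    also for \<open>t = a\<close>.\<close>
  obtain q where "q \<in> \<rat>" "t < q" "q < t + d"
    using Rats_dense_in_real[of t "t + d"] \<open>d > 0\<close> by auto
  then show False
    using d[of q] le[of q] \<open>a \<le> t\<close> by (auto simp: dist_real_def)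
qed

context prob_space
begin

text \<open>On a probability space the essential supremum of the absolute value lies between 0 and
  infinity, and infinity is excluded by membership in \<open>Linf\<close>. Hence
  \<open>real_of_ereal\<close> in \<open>Linf_norm\<close> loses nothing.\<close>

lemma
  assumes "f \<in> Linf M"
  shows Linf_norm_AE: "AE x in M. \<bar>f x\<bar> \<le> Linf_norm M f"
    and Linf_norm_nonneg: "0 \<le> Linf_norm M f"
    and esssup_eq_Linf_norm: "esssup M (\<lambda>x. ereal \<bar>f x\<bar>) = ereal (Linf_norm M f)"
proof -
  have [measurable]: "f \<in> borel_measurable M"
    using assms by (simp add: Linf_def)
  have "0 = esssup M (\<lambda>x. 0 :: ereal)"
    by (simp add: esssup_const emeasure_space_1)
  also have "\<dots> \<le> esssup M (\<lambda>x. ereal \<bar>f x\<bar>)"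
    by (rule esssup_mono) auto
  finally have *: "0 \<le> esssup M (\<lambda>x. ereal \<bar>f x\<bar>)" .
  then show eq: "esssup M (\<lambda>x. ereal \<bar>f x\<bar>) = ereal (Linf_norm M f)"
    using assms by (cases "esssup M (\<lambda>x. ereal \<bar>f x\<bar>)") (auto simp: Linf_def Linf_norm_def)
  with * show "0 \<le> Linf_norm M f"
    by simp
  show "AE x in M. \<bar>f x\<bar> \<le> Linf_norm M f"
    using esssup_AE[of "\<lambda>x. ereal \<bar>f x\<bar>" M] unfolding eq by simp
qed

lemma Linf_I:
  assumes "f \<in> borel_measurable M" "AE x in M. \<bar>f x\<bar> \<le> C"
  shows "f \<in> Linf M" "Linf_norm M f \<le> C"
proof -
  have *: "esssup M (\<lambda>x. ereal \<bar>f x\<bar>) \<le> ereal C"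
    using assms by (intro esssup_I) auto
  then show "f \<in> Linf M"
    using assms(1) by (auto simp: Linf_def)
  from esssup_eq_Linf_norm[OF this] * show "Linf_norm M f \<le> C"
    by simp
qed

lemma Linf_norm_triangle:
  assumes "f \<in> Linf M" "g \<in> Linf M"
  shows "Linf_norm M f \<le> Linf_norm M g + Linf_norm M (f - g)"
proof -
  have [measurable]: "f \<in> borel_measurable M" "g \<in> borel_measurable M"
    using assms by (auto simp: Linf_def)
  have "f - g \<in> Linf M"
  proof (rule Linf_I(1))
    show "f - g \<in> borel_measurable M" by (simp add: fun_diff_def)
    show "AE x in M. \<bar>(f - g) x\<bar> \<le> Linf_norm M f + Linf_norm M g"
      using Linf_norm_AE[OF assms(1)] Linf_norm_AE[OF assms(2)] by eventually_elim auto
  qed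
  from Linf_norm_AE[OF this] Linf_norm_AE[OF assms(2)]
  have "AE x in M. \<bar>f x\<bar> \<le> Linf_norm M g + Linf_norm M (f - g)"
    by eventually_elim auto
  then show ?thesis
    by (intro Linf_I(2)) auto
qed

lemma Linf_norm_uminus: "Linf_norm M (g - f) = Linf_norm M (f - g)"
  by (simp add: Linf_norm_def fun_diff_def abs_minus_commute)

lemma AC_Linf_norm_continuous:
  assumes "r \<in> AC (Linf_norm M) (Linf M)"
  shows "continuous_on {0..} (\<lambda>t. Linf_norm M (r t))"
  unfolding continuous_on_iff
proof (intro ballI allI impI)
  fix t \<epsilon> :: real assume "t \<in> {0..}" "0 < \<epsilon>"
  have Linf: "r s \<in> Linf M" if "0 \<le> s" for s
    using assms that by (simp add: AC_def)
  \<comment> \<open>The horizon \<open>t + 1\<close> leaves room to the right of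
    \<open>t\<close>.\<close>
  have "abs_cont_curve (Linf_norm M) (t + 1) r"
    using assms \<open>t \<in> {0..}\<close> by (simp add: AC_def)
  then obtain \<delta> where "\<delta> > 0" and \<delta>: "\<And>(n::nat) a b.
      (\<And>i. i < n \<Longrightarrow> 0 \<le> a i \<and> a i \<le> b i \<and> b i \<le> t + 1) \<Longrightarrow>
      disjoint_family_on (\<lambda>i. {a i<..<b i}) {..<n} \<Longrightarrow> (\<Sum>i<n. b i - a i) < \<delta> \<Longrightarrow>
      (\<Sum>i<n. Linf_norm M (r (b i) - r (a i))) < \<epsilon>"
    using \<open>0 < \<epsilon>\<close> unfolding abs_cont_curve_def by meson
  \<comment> \<open>Continuity follows from families that consist of a single interval.\<close>
  have \<delta>1: "Linf_norm M (r b - r a) < \<epsilon>" if "0 \<le> a" "a \<le> b" "b \<le> t + 1" "b - a < \<delta>" for a b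
    using \<delta>[of 1 "\<lambda>_. a" "\<lambda>_. b"] that by (simp add: disjoint_family_on_def)
  show "\<exists>d>0. \<forall>s\<in>{0..}. dist s t < d \<longrightarrow> dist (Linf_norm M (r s)) (Linf_norm M (r t)) < \<epsilon>"
  proof (intro exI[of _ "min \<delta> 1"] conjI ballI impI)
    fix s assume "s \<in> {0..}" "dist s t < min \<delta> 1"
    then have "Linf_norm M (r s - r t) < \<epsilon>"
      using \<delta>1[of s t] \<delta>1[of t s] \<open>t \<in> {0..}\<close> Linf_norm_uminus[of "r s" "r t"]
      by (cases "s \<le> t") (auto simp: dist_real_def)
    moreover have "\<bar>Linf_norm M (r s) - Linf_norm M (r t)\<bar> \<le> Linf_norm M (r s - r t)"
      using Linf_norm_triangle[OF Linf Linf, of s t] Linf_norm_triangle[OF Linf Linf, of t s]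
        \<open>s \<in> {0..}\<close> \<open>t \<in> {0..}\<close> Linf_norm_uminus[of "r s" "r t"] by auto
    ultimately show "dist (Linf_norm M (r s)) (Linf_norm M (r t)) < \<epsilon>"
      by (simp add: dist_real_def)
  qed (use \<open>\<delta> > 0\<close> in auto)
qed

end

section \<open>The weights\<close>

lemma at_within_atLeast_eq:
  fixes t :: real
  assumes "t < T"
  shows "at t within {a..} = at t within {a..T}"
  using assms by (intro at_within_nhd[of _ "{..<T}"]) auto

lemma continuous_on_atLeastI:
  fixes f :: "real \<Rightarrow> 'b::topological_space"
  assumes "\<And>T. continuous_on {a..T} f"
  shows "continuous_on {a..} f"
  unfolding continuous_on_eq_continuous_within
proof
  fix t assume "t \<in> {a..}"
  then show "continuous (at t within {a..}) f"
    using assms[of "t + 1"] at_within_atLeast_eq[of t "t + 1" a]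
    by (auto simp: continuous_on_eq_continuous_within)
qed

lemma continuous_of_integral_equation:
  assumes "\<And>t. 0 \<le> t \<Longrightarrow> g integrable_on {0..t}"
    and "\<And>t. 0 \<le> t \<Longrightarrow> f t = c - integral {0..t} g"
  shows "continuous_on {0..} (f :: real \<Rightarrow> real)"
proof (rule continuous_on_atLeastI)
  fix T :: real
  show "continuous_on {0..T} f"
  proof (cases "0 \<le> T")
    case True
    have "continuous_on {0..T} (\<lambda>t. c - integral {0..t} g)"
      using assms(1)[OF True] by (intro continuous_intros indefinite_integral_continuous_1)
    then show ?thesis
      by (rule continuous_on_eq) (simp add: assms(2))
  qed auto
qed

text \<open>The conditions on \<omega> are stated along the curve \<open>r\<close>. Signs of the
  weights and slope bounds for \<alpha> enter as hypotheses of individual lemmas, because for zero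
  mass there is no lower bound for \<omega> along the curve.\<close>

locale co_ncl = prob_space \<mu> for \<mu> :: "'a::euclidean_space measure" +
  fixes K :: "'a set" and \<alpha> :: "real \<Rightarrow> real" and v :: "real \<Rightarrow> real \<Rightarrow> real \<Rightarrow> real"
    and \<omega> :: "real \<Rightarrow> ('a \<Rightarrow> real) \<Rightarrow> 'a \<times> 'a \<Rightarrow> real"
    and r0 :: "'a \<Rightarrow> real" and \<eta>0 :: "'a \<times> 'a \<Rightarrow> real"
    and r :: "real \<Rightarrow> 'a \<Rightarrow> real" and \<eta> :: "real \<Rightarrow> 'a \<times> 'a \<Rightarrow> real" and C\<^sub>\<alpha> C\<^sub>\<omega> :: real
  assumes borel: "sets \<mu> = sets borel"
    and closed_K: "closed K" and AE_K: "AE x in \<mu>. x \<in> K"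
    and r_AC: "r \<in> AC (Linf_norm \<mu>) (Linf \<mu>)"
    and \<eta>_Cb: "\<And>t. 0 \<le> t \<Longrightarrow> \<eta> t \<in> Cb (offdiag K)"
    and solution: "euler_co_ncl_solution \<mu> K Phi_upwind v \<omega> r0 \<eta>0 r \<eta>"
    and v_eq: "\<And>t a b. 0 \<le> t \<Longrightarrow> v t a b = \<alpha> a - \<alpha> b"
    and \<alpha>_cont: "continuous_on UNIV \<alpha>" and \<alpha>_bound: "\<And>a. \<bar>\<alpha> a\<bar> \<le> C\<^sub>\<alpha>"
    and \<omega>_sym: "\<And>t. 0 \<le> t \<Longrightarrow> symmetric_on (offdiag K) (\<omega> t (r t))"
    and \<omega>_bound: "\<And>t z. 0 \<le> t \<Longrightarrow> z \<in> offdiag K \<Longrightarrow> \<bar>\<omega> t (r t) z\<bar> \<le> C\<^sub>\<omega>"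
    and r0_nonneg: "AE x in \<mu>. 0 \<le> r0 x"
    and \<eta>0_sym: "symmetric_on (offdiag K) \<eta>0"
begin

text \<open>The increment form feeds \<open>nonpositive_barrier\<close>: \<omega> is merely
  integrated in time, so \<eta> is not known to be differentiable.\<close>

lemma \<eta>_increment:
  assumes "z \<in> offdiag K" "0 \<le> s" "s \<le> t"
  shows "(\<lambda>\<tau>. \<omega> \<tau> (r \<tau>) z - \<eta> \<tau> z) integrable_on {s..t}"
    and "\<eta> t z - \<eta> s z = integral {s..t} (\<lambda>\<tau>. \<omega> \<tau> (r \<tau>) z - \<eta> \<tau> z)"
    and "\<eta> 0 z = \<eta>0 z"
proof -
  have *: "(\<lambda>\<tau>. \<omega> \<tau> (r \<tau>) z - \<eta> \<tau> z) integrable_on {0..t'}"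
    "\<eta> t' z = \<eta>0 z + integral {0..t'} (\<lambda>\<tau>. \<omega> \<tau> (r \<tau>) z - \<eta> \<tau> z)" if "0 \<le> t'" for t'
    using solution assms(1) that set_lebesgue_integral_eq_integral[of "{0..t'}" "\<lambda>\<tau>. \<omega> \<tau> (r \<tau>) z - \<eta> \<tau> z"]
    unfolding euler_co_ncl_solution_def by auto
  have "0 \<le> t" using assms by simp
  show "(\<lambda>\<tau>. \<omega> \<tau> (r \<tau>) z - \<eta> \<tau> z) integrable_on {s..t}"
    by (rule integrable_on_subinterval[OF *(1)[OF \<open>0 \<le> t\<close>]]) (use assms in auto)
  show "\<eta> t z - \<eta> s z = integral {s..t} (\<lambda>\<tau>. \<omega> \<tau> (r \<tau>) z - \<eta> \<tau> z)"
    using *(2)[OF \<open>0 \<le> s\<close>] *(2)[OF \<open>0 \<le> t\<close>]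
      Henstock_Kurzweil_Integration.integral_combine[OF assms(2,3) *(1)[OF \<open>0 \<le> t\<close>]] by simp
  show "\<eta> 0 z = \<eta>0 z"
    using *(2)[of 0] by simp
qed

lemma \<eta>_continuous:
  assumes "z \<in> offdiag K"
  shows "continuous_on {0..} (\<lambda>t. \<eta> t z)"
proof (rule continuous_on_atLeastI)
  fix T :: real
  show "continuous_on {0..T} (\<lambda>t. \<eta> t z)"
  proof (cases "0 \<le> T")
    case True
    have "continuous_on {0..T} (\<lambda>t. \<eta> 0 z + integral {0..t} (\<lambda>\<tau>. \<omega> \<tau> (r \<tau>) z - \<eta> \<tau> z))"
      using \<eta>_increment(1)[OF assms order_refl True]
      by (intro continuous_intros indefinite_integral_continuous_1)
    then show ?thesis
      by (rule continuous_on_eq) (simp flip: \<eta>_increment(2)[OF assms order_refl])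
  qed auto
qed

text \<open>The source term \<omega> is symmetric and cancels in the difference of the two
  orderings. What remains is pure decay from the initial value zero, so the difference cannot become
  positive. Applying this to both orderings gives equality.\<close>

lemma \<eta>_symmetric:
  assumes "(x, y) \<in> offdiag K" "0 \<le> t"
  shows "\<eta> t (x, y) = \<eta> t (y, x)"
proof -
  have *: "\<eta> t (x, y) - \<eta> t (y, x) \<le> 0" if xy: "(x, y) \<in> offdiag K" for x y
  proof -
    have yx: "(y, x) \<in> offdiag K" using xy by (auto simp: offdiag_def)
    show ?thesis
    proof (rule nonpositive_barrier[where d="\<lambda>t. \<eta> t (x, y) - \<eta> t (y, x)" and a=0])
      show "continuous_on {0..t} (\<lambda>t. \<eta> t (x, y) - \<eta> t (y, x))"
        using \<eta>_continuous[OF xy] \<eta>_continuous[OF yx]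
        by (intro continuous_intros) (auto intro: continuous_on_subset)
      show "\<eta> 0 (x, y) - \<eta> 0 (y, x) \<le> 0"
        using \<eta>_increment(3)[OF xy order_refl order_refl] \<eta>_increment(3)[OF yx order_refl order_refl]
          \<eta>0_sym xy by (auto simp: symmetric_on_def)
    next
      fix s assume s: "0 \<le> s" "s < t"
        and pos: "\<And>\<tau>. \<tau> \<in> {s..t} \<Longrightarrow> 0 \<le> \<eta> \<tau> (x, y) - \<eta> \<tau> (y, x)"
      have "integral {s..t} (\<lambda>\<tau>. \<omega> \<tau> (r \<tau>) (x, y) - \<eta> \<tau> (x, y))
          \<le> integral {s..t} (\<lambda>\<tau>. \<omega> \<tau> (r \<tau>) (y, x) - \<eta> \<tau> (y, x))"
      proof (rule integral_le)
        fix \<tau> assume "\<tau> \<in> {s..t}"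
        moreover from this have "\<omega> \<tau> (r \<tau>) (x, y) = \<omega> \<tau> (r \<tau>) (y, x)"
          using \<omega>_sym[of \<tau>] s xy unfolding symmetric_on_def by auto
        ultimately show "\<omega> \<tau> (r \<tau>) (x, y) - \<eta> \<tau> (x, y) \<le> \<omega> \<tau> (r \<tau>) (y, x) - \<eta> \<tau> (y, x)"
          using pos[of \<tau>] by simp
      qed (use s \<eta>_increment(1)[OF xy] \<eta>_increment(1)[OF yx] in auto)
      then show "\<eta> t (x, y) - \<eta> t (y, x) \<le> \<eta> s (x, y) - \<eta> s (y, x)"
        using \<eta>_increment(2)[OF xy, of s t] \<eta>_increment(2)[OF yx, of s t] s by simp
    qed (rule assms)
  qed
  have "(y, x) \<in> offdiag K" using assms by (auto simp: offdiag_def)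
  then show ?thesis
    using *[OF assms(1)] *[of y x] by simp
qed

text \<open>The weight relaxes towards \<omega>: at or beyond a level above both the initial bound
  and \<open>C\<^sub>\<omega>\<close>, the integrand has the sign that drives it back. The bound is
  therefore uniform in time.\<close>

lemma \<eta>_bounded: "\<exists>H>0. \<forall>t\<ge>0. \<forall>z\<in>offdiag K. \<bar>\<eta> t z\<bar> \<le> H"
proof -
  have "bounded (\<eta> 0 ` offdiag K)"
    using \<eta>_Cb[of 0] by (simp add: Cb_def)
  then obtain B where B: "\<And>z. z \<in> offdiag K \<Longrightarrow> \<bar>\<eta> 0 z\<bar> \<le> B"
    by (force simp: bounded_iff)
  define H where "H = max 1 (max B C\<^sub>\<omega>)"
  have "\<bar>\<eta> t z\<bar> \<le> H" if t: "0 \<le> t" and z: "z \<in> offdiag K" for t z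
  proof -
    have cont: "continuous_on {0..t} (\<lambda>t. \<eta> t z)"
      using \<eta>_continuous[OF z] by (rule continuous_on_subset) auto
    have "\<eta> t z - H \<le> 0"
    proof (rule nonpositive_barrier[where d="\<lambda>t. \<eta> t z - H" and a=0])
      fix s assume s: "0 \<le> s" "s < t" and pos: "\<And>\<tau>. \<tau> \<in> {s..t} \<Longrightarrow> 0 \<le> \<eta> \<tau> z - H"
      have "integral {s..t} (\<lambda>\<tau>. \<omega> \<tau> (r \<tau>) z - \<eta> \<tau> z) \<le> integral {s..t} (\<lambda>\<tau>. 0)"
      proof (rule integral_le)
        fix \<tau> assume "\<tau> \<in> {s..t}"
        then show "\<omega> \<tau> (r \<tau>) z - \<eta> \<tau> z \<le> 0"
          using pos[of \<tau>] \<omega>_bound[OF _ z, of \<tau>] s by (auto simp: H_def)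
      qed (use s \<eta>_increment(1)[OF z] in auto)
      then show "\<eta> t z - H \<le> \<eta> s z - H"
        using \<eta>_increment(2)[OF z, of s t] s by simp
    qed (use B[OF z] t in \<open>auto intro!: continuous_intros cont simp: H_def\<close>)
    moreover have "- \<eta> t z - H \<le> 0"
    proof (rule nonpositive_barrier[where d="\<lambda>t. - \<eta> t z - H" and a=0])
      fix s assume s: "0 \<le> s" "s < t" and pos: "\<And>\<tau>. \<tau> \<in> {s..t} \<Longrightarrow> 0 \<le> - \<eta> \<tau> z - H"
      have "integral {s..t} (\<lambda>\<tau>. 0) \<le> integral {s..t} (\<lambda>\<tau>. \<omega> \<tau> (r \<tau>) z - \<eta> \<tau> z)"
      proof (rule integral_le)
        fix \<tau> assume "\<tau> \<in> {s..t}"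
        then show "0 \<le> \<omega> \<tau> (r \<tau>) z - \<eta> \<tau> z"
          using pos[of \<tau>] \<omega>_bound[OF _ z, of \<tau>] s by (auto simp: H_def)
      qed (use s \<eta>_increment(1)[OF z] in auto)
      then show "- \<eta> t z - H \<le> - \<eta> s z - H"
        using \<eta>_increment(2)[OF z, of s t] s by simp
    qed (use B[OF z] t in \<open>auto intro!: continuous_intros cont simp: H_def\<close>)
    ultimately show ?thesis by simp
  qed
  then show ?thesis
    by (intro exI[of _ H]) (auto simp: H_def)
qed

text \<open>Below the barrier \<open>c * min t 1 \<le> c\<close> the growth rate of \<eta> is at
  least \<open>2 * c - c = c\<close>, which is no less than the slope of the barrier. The barrier
  starts at 0 because a positive initial weight may have infimum 0 off the diagonal; a uniform
  positive bound is available from time 1.\<close>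

lemma \<eta>_lower_bound:
  assumes pos: "\<And>z. z \<in> offdiag K \<Longrightarrow> 0 \<le> \<eta>0 z"
    and ge: "\<And>t z. 0 \<le> t \<Longrightarrow> z \<in> offdiag K \<Longrightarrow> 2 * c \<le> \<omega> t (r t) z"
    and "0 \<le> c" and z: "z \<in> offdiag K" and t: "0 \<le> t"
  shows "c * min t 1 \<le> \<eta> t z"
proof -
  have cont: "continuous_on {0..t} (\<lambda>t. \<eta> t z)"
    using \<eta>_continuous[OF z] by (rule continuous_on_subset) auto
  have "c * min t 1 - \<eta> t z \<le> 0"
  proof (rule nonpositive_barrier[where d="\<lambda>t. c * min t 1 - \<eta> t z" and a=0])
    fix s assume s: "0 \<le> s" "s < t" and d: "\<And>\<tau>. \<tau> \<in> {s..t} \<Longrightarrow> 0 \<le> c * min \<tau> 1 - \<eta> \<tau> z"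
    have "c \<le> \<omega> \<tau> (r \<tau>) z - \<eta> \<tau> z" if "\<tau> \<in> {s..t}" for \<tau>
      using d[OF that] ge[OF _ z, of \<tau>] that s \<open>0 \<le> c\<close> mult_left_mono[of "min \<tau> 1" 1 c] by auto
    then have "integral {s..t} (\<lambda>\<tau>. c) \<le> integral {s..t} (\<lambda>\<tau>. \<omega> \<tau> (r \<tau>) z - \<eta> \<tau> z)"
      using s \<eta>_increment(1)[OF z] by (intro integral_le) auto
    then have "c * (t - s) \<le> \<eta> t z - \<eta> s z"
      using \<eta>_increment(2)[OF z, of s t] s by (simp add: mult.commute)
    moreover have "c * (min t 1 - min s 1) \<le> c * (t - s)"
      using s \<open>0 \<le> c\<close> by (intro mult_left_mono) auto
    ultimately show "c * min t 1 - \<eta> t z \<le> c * min s 1 - \<eta> s z"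
      by (simp add: algebra_simps)
  qed (use pos[OF z] \<eta>_increment(3)[OF z order_refl order_refl] t in \<open>auto intro!: continuous_intros cont\<close>)
  then show ?thesis by simp
qed

section \<open>Regularity in time\<close>

definition flux :: "real \<Rightarrow> 'a \<Rightarrow> 'a \<Rightarrow> real" where
  "flux s x y = indicat_real (K - {x}) y *
     (Phi_upwind (r s x) (r s y) (\<alpha> (r s x) - \<alpha> (r s y)) * \<eta> s (x, y))"

definition outflow :: "real \<Rightarrow> 'a \<Rightarrow> real" where
  "outflow s x = (LINT y|\<mu>. flux s x y)"

text \<open>The points at which the equation and the bounds hold simultaneously for all times. They
  carry the full measure, so that suprema over this set can replace essential suprema.\<close>

definition good :: "'a set" where
  "good = {x \<in> K. 0 \<le> r0 x \<and> (\<forall>s\<ge>0. integrable \<mu> (flux s x)) \<and>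
     (\<forall>t\<ge>0. (\<lambda>s. outflow s x) integrable_on {0..t} \<and>
        r t x = r0 x - integral {0..t} (\<lambda>s. outflow s x)) \<and>
     (\<forall>t\<ge>0. \<bar>r t x\<bar> \<le> Linf_norm \<mu> (r t))}"

lemma r_Linf: "0 \<le> t \<Longrightarrow> r t \<in> Linf \<mu>"
  using r_AC by (simp add: AC_def)

lemma r_measurable [measurable]: "0 \<le> t \<Longrightarrow> r t \<in> borel_measurable \<mu>"
  using r_Linf by (simp add: Linf_def)

text \<open>The bound by the norm holds almost everywhere with a null set that depends on the time.
  It is collected over the rational times first and then extended to all times, since both sides are
  continuous in time.\<close>

lemma AE_good: "AE x in \<mu>. x \<in> good"
proof -
  have Phi_v: "Phi_upwind (r s x) (r s y) (v s (r s x) (r s y)) * \<eta> s (x, y) =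
      Phi_upwind (r s x) (r s y) (\<alpha> (r s x) - \<alpha> (r s y)) * \<eta> s (x, y)" if "0 \<le> s" for s x y
    using v_eq[OF that] by simp
  have "AE x in \<mu>. x \<in> K \<longrightarrow>
      (\<forall>s\<ge>0. integrable \<mu> (flux s x)) \<and>
      (\<forall>t\<ge>0. (\<lambda>s. outflow s x) integrable_on {0..t} \<and>
        r t x = r0 x - integral {0..t} (\<lambda>s. outflow s x))"
    using solution[unfolded euler_co_ncl_solution_def Let_def, THEN conjunct2, THEN conjunct2, THEN conjunct1]
  proof eventually_elim
    case (elim x)
    let ?v = "\<lambda>s y. Phi_upwind (r s x) (r s y) (v s (r s x) (r s y)) * \<eta> s (x, y)"
    have out: "(LINT y:K - {x}|\<mu>. ?v s y) = outflow s x" if "0 \<le> s" for s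
      unfolding outflow_def flux_def set_lebesgue_integral_def Phi_v[OF that] by simp
    have int: "integral {0..t} (\<lambda>s. LINT y:K - {x}|\<mu>. ?v s y) = integral {0..t} (\<lambda>s. outflow s x)" for t
      by (rule integral_cong) (simp add: out)
    show ?case
    proof (intro impI conjI allI)
      assume "x \<in> K"
      note * = mp[OF elim this]
      show "integrable \<mu> (flux s x)" if "0 \<le> s" for s
        using conjunct1[OF *] that unfolding flux_def set_integrable_def by (simp add: Phi_v)
      fix t :: real assume "0 \<le> t"
      with * have ai: "(\<lambda>s. LINT y:K - {x}|\<mu>. ?v s y) absolutely_integrable_on {0..t}"
        and r: "r t x = r0 x - (LINT s:{0..t}|lebesgue. LINT y:K - {x}|\<mu>. ?v s y)"
        by auto
      have "(\<lambda>s. LINT y:K - {x}|\<mu>. ?v s y) integrable_on {0..t}"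
        using set_lebesgue_integral_eq_integral(1)[OF ai] .
      then show "(\<lambda>s. outflow s x) integrable_on {0..t}"
        by (rule integrable_eq) (simp add: out)
      show "r t x = r0 x - integral {0..t} (\<lambda>s. outflow s x)"
        using r set_lebesgue_integral_eq_integral(2)[OF ai] by (simp add: int)
    qed
  qed
  moreover have "AE x in \<mu>. \<forall>q\<in>\<rat> \<inter> {0..}. \<bar>r q x\<bar> \<le> Linf_norm \<mu> (r q)"
    using Linf_norm_AE[OF r_Linf]
    by (subst AE_ball_countable) (auto intro: countable_Int1 countable_rat)
  ultimately show ?thesis
    using AE_K r0_nonneg
  proof eventually_elim
    case (elim x)
    then have *: "\<And>t. 0 \<le> t \<Longrightarrow> (\<lambda>s. outflow s x) integrable_on {0..t}"
      "\<And>t. 0 \<le> t \<Longrightarrow> r t x = r0 x - integral {0..t} (\<lambda>s. outflow s x)" by auto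
    have "continuous_on {0..} (\<lambda>t. \<bar>r t x\<bar>)"
      using continuous_of_integral_equation[of "\<lambda>s. outflow s x" "\<lambda>t. r t x", OF *]
      by (intro continuous_intros) auto
    from continuous_on_le_of_Rats[OF this AC_Linf_norm_continuous[OF r_AC]] elim
    have "\<forall>t\<ge>0. \<bar>r t x\<bar> \<le> Linf_norm \<mu> (r t)" by auto
    with elim show ?case by (simp add: good_def)
  qed
qed

lemma
  assumes "x \<in> good"
  shows good_in_K: "x \<in> K"
    and flux_integrable: "0 \<le> s \<Longrightarrow> integrable \<mu> (flux s x)"
    and outflow_integrable: "0 \<le> t \<Longrightarrow> (\<lambda>s. outflow s x) integrable_on {0..t}"
    and r_eq: "0 \<le> t \<Longrightarrow> r t x = r0 x - integral {0..t} (\<lambda>s. outflow s x)"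
    and r_le_norm: "0 \<le> t \<Longrightarrow> \<bar>r t x\<bar> \<le> Linf_norm \<mu> (r t)"
  using assms by (auto simp: good_def)

lemma r_0: "x \<in> good \<Longrightarrow> r 0 x = r0 x"
  using r_eq[of x 0] by simp

lemma r_0_nonneg: "x \<in> good \<Longrightarrow> 0 \<le> r 0 x"
  using r_0 by (auto simp: good_def)

lemma r_continuous: "x \<in> good \<Longrightarrow> continuous_on {0..} (\<lambda>t. r t x)"
  using continuous_of_integral_equation[of "\<lambda>s. outflow s x" "\<lambda>t. r t x"] outflow_integrable r_eq
  by auto

text \<open>The bound is uniform over the good points, as \<open>sup_gronwall\<close> requires; it
  comes from the continuous norm on a compact time interval.\<close>

lemma r_locally_bounded: "\<exists>R\<ge>0. \<forall>x\<in>good. \<forall>t\<in>{0..T}. \<bar>r t x\<bar> \<le> R"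
proof -
  have "compact ((\<lambda>t. Linf_norm \<mu> (r t)) ` {0..T})"
    using AC_Linf_norm_continuous[OF r_AC]
    by (intro compact_continuous_image) (auto intro: continuous_on_subset)
  then obtain R where "\<And>t. t \<in> {0..T} \<Longrightarrow> Linf_norm \<mu> (r t) \<le> R"
    by (metis bounded_has_Sup(1) compact_imp_bounded empty_iff imageI)
  then have "\<forall>x\<in>good. \<forall>t\<in>{0..T}. \<bar>r t x\<bar> \<le> max 0 R"
    using r_le_norm by (fastforce simp: le_max_iff_disj)
  then show ?thesis
    by (intro exI[of _ "max 0 R"]) auto
qed

text \<open>The diagonal may be treated like any other point, with an arbitrary weight in \<open>E\<close>,
  because \<open>\<Phi>\<close> vanishes there.\<close>

lemma
  assumes x: "x \<in> good" and t: "0 \<le> t" and f: "integrable \<mu> f" and "E \<noteq> {}"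
    and E: "\<And>z. z \<in> offdiag K \<Longrightarrow> \<eta> t z \<in> E"
  shows outflow_le: "(\<And>y e. y \<in> good \<Longrightarrow> e \<in> E \<Longrightarrow>
      Phi_upwind (r t x) (r t y) (\<alpha> (r t x) - \<alpha> (r t y)) * e \<le> f y) \<Longrightarrow> outflow t x \<le> (LINT y|\<mu>. f y)"
    and neg_outflow_le: "(\<And>y e. y \<in> good \<Longrightarrow> e \<in> E \<Longrightarrow>
      - (Phi_upwind (r t x) (r t y) (\<alpha> (r t x) - \<alpha> (r t y)) * e) \<le> f y) \<Longrightarrow> - outflow t x \<le> (LINT y|\<mu>. f y)"
proof -
  have *: "\<exists>e\<in>E. flux t x y = Phi_upwind (r t x) (r t y) (\<alpha> (r t x) - \<alpha> (r t y)) * e" if "y \<in> good" for y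
  proof (cases "y = x")
    case True
    then show ?thesis
      using \<open>E \<noteq> {}\<close> by (auto simp: flux_def Phi_upwind_def)
  next
    case False
    then show ?thesis
      using E[of "(x, y)"] that x by (auto simp: flux_def offdiag_def good_in_K)
  qed
  show "outflow t x \<le> (LINT y|\<mu>. f y)" if "\<And>y e. y \<in> good \<Longrightarrow> e \<in> E \<Longrightarrow>
      Phi_upwind (r t x) (r t y) (\<alpha> (r t x) - \<alpha> (r t y)) * e \<le> f y"
    unfolding outflow_def
  proof (rule integral_mono_AE[OF flux_integrable[OF x t] f])
    show "AE y in \<mu>. flux t x y \<le> f y"
      using AE_good by eventually_elim (use * that in force)
  qed
  show "- outflow t x \<le> (LINT y|\<mu>. f y)" if "\<And>y e. y \<in> good \<Longrightarrow> e \<in> E \<Longrightarrow>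
      - (Phi_upwind (r t x) (r t y) (\<alpha> (r t x) - \<alpha> (r t y)) * e) \<le> f y"
    unfolding outflow_def integral_minus[symmetric]
  proof (rule integral_mono_AE[OF _ f])
    show "integrable \<mu> (\<lambda>y. - flux t x y)"
      using flux_integrable[OF x t] by simp
    show "AE y in \<mu>. - flux t x y \<le> f y"
      using AE_good by eventually_elim (use * that in force)
  qed
qed

lemma abs_Phi_weighted_le:
  assumes "\<bar>a\<bar> \<le> P" "\<bar>b\<bar> \<le> P" "\<bar>e\<bar> \<le> H"
  shows "\<bar>Phi_upwind a b (\<alpha> a - \<alpha> b) * e\<bar> \<le> 2 * C\<^sub>\<alpha> * H * P"
proof -
  have "0 \<le> P" "0 \<le> C\<^sub>\<alpha>"
    using assms(1) \<alpha>_bound[of 0] by linarith+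
  have "\<bar>Phi_upwind a b (\<alpha> a - \<alpha> b)\<bar> \<le> P * \<bar>\<alpha> a - \<alpha> b\<bar>"
    using assms by (intro abs_Phi_upwind_le)
  also have "\<dots> \<le> P * (2 * C\<^sub>\<alpha>)"
    using \<alpha>_bound[of a] \<alpha>_bound[of b] \<open>0 \<le> P\<close> by (intro mult_left_mono) linarith+
  finally have "\<bar>Phi_upwind a b (\<alpha> a - \<alpha> b)\<bar> * \<bar>e\<bar> \<le> P * (2 * C\<^sub>\<alpha>) * H"
    using assms(3) \<open>0 \<le> P\<close> \<open>0 \<le> C\<^sub>\<alpha>\<close> by (intro mult_mono) auto
  then show ?thesis
    by (simp add: abs_mult mult_ac)
qed

text \<open>The linear dependence on \<open>P\<close> is what lets a Gronwall argument propagate the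
  value zero.\<close>

lemma abs_outflow_le:
  assumes "x \<in> good" "0 \<le> t" "\<And>y. y \<in> good \<Longrightarrow> \<bar>r t y\<bar> \<le> P"
    and "\<And>z. z \<in> offdiag K \<Longrightarrow> \<bar>\<eta> t z\<bar> \<le> H" and "0 \<le> H"
  shows "\<bar>outflow t x\<bar> \<le> 2 * C\<^sub>\<alpha> * H * P"
proof -
  \<comment> \<open>The range of weights is a symmetric interval because no sign of \<eta> is known
    here.\<close>
  have E: "{- H..H} \<noteq> {}" "\<And>z. z \<in> offdiag K \<Longrightarrow> \<eta> t z \<in> {- H..H}"
    using assms(4,5) by (auto simp: abs_le_iff minus_le_iff)
  have b: "\<bar>Phi_upwind (r t x) (r t y) (\<alpha> (r t x) - \<alpha> (r t y)) * e\<bar> \<le> 2 * C\<^sub>\<alpha> * H * P"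
    if "y \<in> good" "e \<in> {- H..H}" for y e
    using that assms by (intro abs_Phi_weighted_le) auto
  have "outflow t x \<le> (LINT y|\<mu>. 2 * C\<^sub>\<alpha> * H * P)"
    by (rule outflow_le[OF assms(1,2) _ E]) (use b in \<open>auto simp: abs_le_iff\<close>)
  moreover have "- outflow t x \<le> (LINT y|\<mu>. 2 * C\<^sub>\<alpha> * H * P)"
    by (rule neg_outflow_le[OF assms(1,2) _ E]) (use b in \<open>auto simp: abs_le_iff\<close>)
  ultimately show ?thesis
    by (simp add: prob_space)
qed

lemma outflow_locally_bounded: "\<exists>C\<ge>0. \<forall>x\<in>good. \<forall>t\<in>{0..T}. \<bar>outflow t x\<bar> \<le> C"
proof -
  obtain R where "R \<ge> 0" and R: "\<forall>x\<in>good. \<forall>t\<in>{0..T}. \<bar>r t x\<bar> \<le> R"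
    using r_locally_bounded by blast
  obtain H where "H > 0" and H: "\<forall>t\<ge>0. \<forall>z\<in>offdiag K. \<bar>\<eta> t z\<bar> \<le> H"
    using \<eta>_bounded by blast
  have "0 \<le> C\<^sub>\<alpha>" using \<alpha>_bound[of 0] by linarith
  then show ?thesis
    using R H \<open>H > 0\<close> \<open>R \<ge> 0\<close>
    by (intro exI[of _ "2 * C\<^sub>\<alpha> * H * R"] conjI ballI abs_outflow_le mult_nonneg_nonneg) auto
qed

text \<open>Dominated convergence along sequences of times; the flux is continuous in time for each
  good \<open>y\<close> and bounded by a constant. This makes \<open>r\<close> differentiable at
  every time, not just almost every time.\<close>

lemma outflow_continuous:
  assumes x: "x \<in> good"
  shows "continuous_on {0..} (\<lambda>t. outflow t x)"
proof (rule continuous_on_atLeastI)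
  fix T :: real
  obtain R where R: "\<forall>x\<in>good. \<forall>t\<in>{0..T}. \<bar>r t x\<bar> \<le> R"
    using r_locally_bounded by blast
  obtain H where H: "\<forall>t\<ge>0. \<forall>z\<in>offdiag K. \<bar>\<eta> t z\<bar> \<le> H" "H > 0"
    using \<eta>_bounded by blast
  have \<alpha>_comp: "continuous_on S (\<lambda>x. \<alpha> (f x))" if "continuous_on S f" for S and f :: "real \<Rightarrow> real"
    using continuous_on_compose2[OF \<alpha>_cont that] by simp
  have flux_cont: "continuous_on {0..} (\<lambda>t. flux t x y)" if "y \<in> good" for y
  proof (cases "y = x")
    case True
    then show ?thesis by (simp add: flux_def)
  next
    case False
    then have "(x, y) \<in> offdiag K"
      using that x by (auto simp: offdiag_def good_in_K)
    then show ?thesis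
      unfolding flux_def by (intro continuous_intros r_continuous \<alpha>_comp \<eta>_continuous x that)
  qed
  have flux_bound: "\<bar>flux t x y\<bar> \<le> 2 * C\<^sub>\<alpha> * H * R" if "y \<in> good" "t \<in> {0..T}" for t y
  proof (cases "y = x")
    case True
    have "0 \<le> C\<^sub>\<alpha>" using \<alpha>_bound[of 0] by linarith
    moreover have "0 \<le> R" using R that by fastforce
    ultimately show ?thesis
      using True H by (simp add: flux_def)
  next
    case False
    then have "(x, y) \<in> offdiag K" "flux t x y = Phi_upwind (r t x) (r t y) (\<alpha> (r t x) - \<alpha> (r t y)) * \<eta> t (x, y)"
      using that x by (auto simp: flux_def offdiag_def good_in_K)
    then show ?thesis
      using abs_Phi_weighted_le[of "r t x" R "r t y" "\<eta> t (x, y)" H] R H x that by auto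
  qed
  show "continuous_on {0..T} (\<lambda>t. outflow t x)"
  proof (rule continuous_on_sequentiallyI)
    fix X t assume X: "\<forall>n. X n \<in> {0..T}" and t: "t \<in> {0..T}" and lim: "X \<longlonglongrightarrow> t"
    show "(\<lambda>n. outflow (X n) x) \<longlonglongrightarrow> outflow t x"
      unfolding outflow_def
    proof (rule integral_dominated_convergence[where w="\<lambda>_. 2 * C\<^sub>\<alpha> * H * R"])
      show "AE y in \<mu>. (\<lambda>n. flux (X n) x y) \<longlonglongrightarrow> flux t x y"
        using AE_good
      proof eventually_elim
        case (elim y)
        show ?case
          by (rule continuous_on_tendsto_compose[OF flux_cont[OF elim] lim]) (use X t in auto)
      qed
      show "AE y in \<mu>. norm (flux (X n) x y) \<le> 2 * C\<^sub>\<alpha> * H * R" for n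
        using AE_good by eventually_elim (use X flux_bound in auto)
    qed (use X t flux_integrable[OF x] in auto)
  qed
qed

lemma r_has_derivative:
  assumes x: "x \<in> good" and "0 \<le> t" "t \<le> T"
  shows "((\<lambda>t. r t x) has_real_derivative - outflow t x) (at t within {0..T})"
proof -
  have "continuous_on {0..T} (\<lambda>t. outflow t x)"
    using outflow_continuous[OF x] by (rule continuous_on_subset) auto
  from integral_has_real_derivative[OF this, of t] assms(2,3)
  have "((\<lambda>t. r0 x - integral {0..t} (\<lambda>s. outflow s x)) has_real_derivative - outflow t x) (at t within {0..T})"
    by (auto intro!: derivative_eq_intros)
  then show ?thesis
    by (rule has_field_derivative_transform_within[where d=1]) (use assms r_eq[OF x] in auto)
qed

section \<open>Conservation of mass\<close>

text \<open>Swapping the two points reverses the sign of the flux, and Fubini's theorem turns this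
  into a vanishing integral. Since nothing is known about \<open>outflow t\<close> off the good
  points, the statement is about a measurable version \<open>F\<close>.\<close>

lemma outflow_mean_zero:
  assumes t: "0 \<le> t"
  shows "\<exists>F\<in>borel_measurable \<mu>. (AE x in \<mu>. outflow t x = F x) \<and> (LINT x|\<mu>. F x) = 0"
proof -
  interpret P: pair_prob_space \<mu> \<mu> ..
  obtain R where "R \<ge> 0" and R: "\<forall>x\<in>good. \<forall>s\<in>{0..t}. \<bar>r s x\<bar> \<le> R"
    using r_locally_bounded by blast
  obtain H where H: "\<forall>t\<ge>0. \<forall>z\<in>offdiag K. \<bar>\<eta> t z\<bar> \<le> H" "H > 0"
    using \<eta>_bounded by blast
  \<comment> \<open>Truncation leaves the values at good points unchanged and makes \<open>G\<close>
    bounded everywhere, hence integrable on the product space.\<close>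
  define \<rho> where "\<rho> x = max (- R) (min R (r t x))" for x
  define e where "e z = indicator (offdiag K) z * \<eta> t z" for z
  define G where "G x y = Phi_upwind (\<rho> x) (\<rho> y) (\<alpha> (\<rho> x) - \<alpha> (\<rho> y)) * e (x, y)" for x y
  have [measurable]: "\<rho> \<in> borel_measurable \<mu>"
    unfolding \<rho>_def using r_measurable[OF t] by measurable
  have [measurable]: "\<alpha> \<in> borel_measurable borel"
    using \<alpha>_cont by (rule borel_measurable_continuous_onI)
  \<comment> \<open>The weight is continuous only on the off-diagonal set. As this set is Borel, the
    extension by zero is Borel measurable.\<close>
  have "offdiag K = (K \<times> K) \<inter> - {z. fst z = snd z}"
    by (auto simp: offdiag_def)
  moreover have "closed {z :: 'a \<times> 'a. fst z = snd z}"
    by (intro closed_Collect_eq continuous_intros)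
  ultimately have "offdiag K \<in> sets borel"
    using closed_K by (simp add: sets.Int borel_closed borel_comp closed_Times)
  then have "e \<in> borel_measurable borel"
    using \<eta>_Cb[OF t] borel_measurable_continuous_on_indicator[of "offdiag K" "\<eta> t"]
    by (auto simp: e_def[abs_def] Cb_def)
  moreover have "sets (\<mu> \<Otimes>\<^sub>M \<mu>) = sets (borel :: ('a \<times> 'a) measure)"
    unfolding borel_prod[symmetric] by (rule sets_pair_measure_cong) (rule borel)+
  ultimately have [measurable]: "e \<in> borel_measurable (\<mu> \<Otimes>\<^sub>M \<mu>)"
    by (simp cong: measurable_cong_sets)
  have G_measurable [measurable]: "case_prod G \<in> borel_measurable (\<mu> \<Otimes>\<^sub>M \<mu>)"
    unfolding G_def by measurable
  have "\<bar>G x y\<bar> \<le> 2 * C\<^sub>\<alpha> * H * R" for x y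
    unfolding G_def using H t \<open>R \<ge> 0\<close>
    by (intro abs_Phi_weighted_le) (auto simp: \<rho>_def e_def indicator_def)
  then have "integrable (\<mu> \<Otimes>\<^sub>M \<mu>) (case_prod G)"
    by (intro P.P.integrable_const_bound[where B="2 * C\<^sub>\<alpha> * H * R"]) auto
  then have swap: "(LINT y|\<mu>. LINT x|\<mu>. G x y) = (LINT x|\<mu>. LINT y|\<mu>. G x y)"
    by (rule P.Fubini_integral)
  have "e (y, x) = e (x, y)" for x y
    using \<eta>_symmetric[OF _ t, of x y] by (auto simp: e_def indicator_def offdiag_def)
  then have "G x y = - G y x" for x y
    using Phi_upwind_swap[of "\<rho> x" "\<rho> y" "\<alpha> (\<rho> y) - \<alpha> (\<rho> x)"] by (simp add: G_def)
  then have "(LINT y|\<mu>. LINT x|\<mu>. G x y) = (LINT y|\<mu>. LINT x|\<mu>. - G y x)"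
    by (intro Bochner_Integration.integral_cong refl)
  with swap have "(LINT x|\<mu>. LINT y|\<mu>. G x y) = 0"
    by simp
  moreover have "AE x in \<mu>. outflow t x = (LINT y|\<mu>. G x y)"
    using AE_good
  proof eventually_elim
    case (elim x)
    have "AE y in \<mu>. flux t x y = G x y"
      using AE_good
    proof eventually_elim
      case y: (elim y)
      have "\<bar>r t x\<bar> \<le> R" "\<bar>r t y\<bar> \<le> R"
        using R elim y t by auto
      then have "\<rho> x = r t x" "\<rho> y = r t y"
        by (auto simp: \<rho>_def abs_le_iff)
      then show ?case
        using elim y by (auto simp: flux_def G_def e_def indicator_def offdiag_def good_in_K)
    qed
    moreover have "x \<in> space \<mu>"
      using sets_eq_imp_space_eq[OF borel] by simp
    then have "G x \<in> borel_measurable \<mu>"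
      using measurable_Pair2[OF G_measurable] by simp
    ultimately show ?case
      unfolding outflow_def using flux_integrable[OF elim t]
      by (intro integral_cong_AE) auto
  qed
  moreover have "(\<lambda>x. LINT y|\<mu>. G x y) \<in> borel_measurable \<mu>"
    by measurable
  ultimately show ?thesis
    by (intro bexI[of _ "\<lambda>x. LINT y|\<mu>. G x y"] conjI)
qed

lemma r_integrable: "0 \<le> t \<Longrightarrow> integrable \<mu> (r t)"
  using Linf_norm_AE[OF r_Linf] by (intro integrable_const_bound[where B="Linf_norm \<mu> (r t)"]) auto

text \<open>Differentiation under the integral sign: the difference quotients converge to minus the
  outflow, which has mean zero. Arguing at each time separately avoids joint measurability of the
  outflow in time and space.\<close>

lemma mass_conserved:
  assumes "0 \<le> t"
  shows "(LINT x|\<mu>. r t x) = (LINT x|\<mu>. r 0 x)"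
proof -
  obtain C where C: "\<forall>x\<in>good. \<forall>s\<in>{0..t}. \<bar>outflow s x\<bar> \<le> C"
    using outflow_locally_bounded by blast
  have "((\<lambda>s. LINT x|\<mu>. r s x) has_real_derivative 0) (at s within {0..t})" if s: "s \<in> {0..t}" for s
    unfolding has_field_derivative_iff tendsto_at_iff_sequentially
  proof (intro allI impI)
    fix X assume X: "\<forall>i. X i \<in> {0..t} - {s}" and lim: "X \<longlonglongrightarrow> s"
    obtain F where F [measurable]: "F \<in> borel_measurable \<mu>"
      and F_eq: "AE x in \<mu>. outflow s x = F x" and F0: "(LINT x|\<mu>. F x) = 0"
      using outflow_mean_zero[of s] s by auto
    have "(\<lambda>i. LINT x|\<mu>. (r (X i) x - r s x) / (X i - s)) \<longlonglongrightarrow> (LINT x|\<mu>. - F x)"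
    proof (rule integral_dominated_convergence[where w="\<lambda>_. C"])
      show "AE x in \<mu>. (\<lambda>i. (r (X i) x - r s x) / (X i - s)) \<longlonglongrightarrow> - F x"
        using AE_good F_eq
      proof eventually_elim
        case (elim x)
        then have "((\<lambda>\<tau>. r \<tau> x) has_real_derivative - F x) (at s within {0..t})"
          using r_has_derivative[of x s t] s by simp
        then show ?case
          using X lim unfolding has_field_derivative_iff tendsto_at_iff_sequentially comp_def by simp
      qed
      show "AE x in \<mu>. norm ((r (X i) x - r s x) / (X i - s)) \<le> C" for i
        using AE_good
      proof eventually_elim
        case (elim x)
        \<comment> \<open>The mean value inequality yields a dominating constant independent of
          \<open>x\<close>.\<close>
        have "norm (r (X i) x - r s x) \<le> C * norm (X i - s)"
          using elim C X s
          by (intro field_differentiable_bound[of "{0..t}" "\<lambda>\<tau>. r \<tau> x" "\<lambda>\<tau>. - outflow \<tau> x"] r_has_derivative) auto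
        then show ?case
          using X by (simp add: norm_divide divide_le_eq)
      qed
    qed (use X s in auto)
    moreover have eq: "(LINT x|\<mu>. (r (X i) x - r s x) / (X i - s)) =
        ((LINT x|\<mu>. r (X i) x) - (LINT x|\<mu>. r s x)) / (X i - s)" for i
      using r_integrable X s by simp
    ultimately show "((\<lambda>\<tau>. ((LINT x|\<mu>. r \<tau> x) - (LINT x|\<mu>. r s x)) / (\<tau> - s)) \<circ> X) \<longlonglongrightarrow> 0"
      using F0 unfolding comp_def eq[symmetric] by simp
  qed
  then obtain c where "\<And>s. s \<in> {0..t} \<Longrightarrow> (LINT x|\<mu>. r s x) = c"
    using has_field_derivative_zero_constant[of "{0..t}" "\<lambda>s. LINT x|\<mu>. r s x"] by auto
  from this[of 0] this[of t] assms show ?thesis by simp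
qed

section \<open>Decay towards the mean\<close>

lemma r_has_derivative_within:
  assumes "x \<in> good" "0 \<le> a" "s \<in> {a..t}"
  shows "((\<lambda>s. r s x) has_real_derivative - outflow s x) (at s within {a..t})"
  by (rule DERIV_subset[OF r_has_derivative[of x s t]]) (use assms in auto)

text \<open>Both signs are treated at once, because \<open>\<eta>\<close> may be negative here: the lower bound on \<open>\<omega>\<close>
  excludes \<open>r = 0\<close>.\<close>

lemma r_zero:
  assumes mass: "(LINT x|\<mu>. r 0 x) = 0" and x: "x \<in> good" and t: "0 \<le> t"
  shows "r t x = 0"
proof -
  have "AE x in \<mu>. 0 \<le> r 0 x"
    using AE_good by eventually_elim (rule r_0_nonneg)
  then have "AE x in \<mu>. r 0 x = 0"
    using mass integral_nonneg_eq_0_iff_AE[OF r_integrable[of 0]] by simp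
  then have "AE x in \<mu>. \<bar>r 0 x\<bar> \<le> 0"
    by eventually_elim simp
  \<comment> \<open>Passing through the norm upgrades vanishing almost everywhere to vanishing at
    every good point.\<close>
  then have "Linf_norm \<mu> (r 0) \<le> 0"
    by (intro Linf_I(2)) auto
  then have init: "r 0 x = 0" if "x \<in> good" for x
    using r_le_norm[OF that, of 0] by simp
  obtain R where R: "\<forall>x\<in>good. \<forall>s\<in>{0..t}. \<bar>r s x\<bar> \<le> R"
    using r_locally_bounded by blast
  obtain C where C: "\<forall>x\<in>good. \<forall>s\<in>{0..t}. \<bar>outflow s x\<bar> \<le> C"
    using outflow_locally_bounded by blast
  obtain H where H: "\<forall>t\<ge>0. \<forall>z\<in>offdiag K. \<bar>\<eta> t z\<bar> \<le> H" "H > 0"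
    using \<eta>_bounded by blast
  have C\<alpha>: "0 \<le> C\<^sub>\<alpha>" using \<alpha>_bound[of 0] by linarith
  \<comment> \<open>The index carries a sign, so that the supremum over the family is that of the
    absolute value.\<close>
  let ?u = "\<lambda>(x, \<sigma>) s. \<sigma> * r s x" and ?g = "\<lambda>(x, \<sigma>) s. - (\<sigma> * outflow s x)"
  have "?u i t \<le> 0 * exp ((2 * C\<^sub>\<alpha> * H - 0) * (t - 0))" if "i \<in> good \<times> {1, - 1}" for i
  proof (rule sup_gronwall[where I="good \<times> {1, - 1 :: real}" and g="?g" and R=R and C=C and b=t])
    fix i s assume "i \<in> good \<times> {1, - 1 :: real}" and s: "s \<in> {0..t}"
    then obtain x \<sigma> where i: "i = (x, \<sigma>)" "x \<in> good" "\<sigma> = 1 \<or> \<sigma> = - 1" by auto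
    show "(?u i has_real_derivative ?g i s) (at s within {0..t})"
      using DERIV_cmult[OF r_has_derivative_within[OF i(2) order_refl s], of \<sigma>] by (simp add: i)
    show "?u i s \<le> R" "\<bar>?g i s\<bar> \<le> C"
      using R C i s by (force simp: abs_le_iff)+
    fix P assume "0 \<le> P" and P: "\<And>j. j \<in> good \<times> {1, - 1} \<Longrightarrow> ?u j s \<le> P"
    have "\<bar>r s y\<bar> \<le> P" if "y \<in> good" for y
      using P[of "(y, 1)"] P[of "(y, - 1)"] that by auto
    then have "\<bar>outflow s x\<bar> \<le> 2 * C\<^sub>\<alpha> * H * P"
      using i(2) s H by (intro abs_outflow_le) auto
    then show "?g i s + 0 * ?u i s \<le> 2 * C\<^sub>\<alpha> * H * P"
      using i by (auto simp: abs_le_iff)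
  qed (use t that init C\<alpha> H in auto)
  from this[of "(x, 1)"] this[of "(x, - 1)"] x show ?thesis
    by auto
qed

text \<open>Gronwall's lemma for \<open>- r\<close>: if no value lies below \<open>- P\<close>, then
  \<open>- r\<close> grows at a rate controlled by \<open>P\<close>. The initial bound is 0, so the
  exponential factor is harmless.\<close>

lemma r_nonneg:
  assumes \<eta>_nonneg: "\<And>t z. 0 \<le> t \<Longrightarrow> z \<in> offdiag K \<Longrightarrow> 0 \<le> \<eta> t z"
    and x: "x \<in> good" and t: "0 \<le> t"
  shows "0 \<le> r t x"
proof -
  obtain R where R: "\<forall>x\<in>good. \<forall>s\<in>{0..t}. \<bar>r s x\<bar> \<le> R"
    using r_locally_bounded by blast
  obtain C where C: "\<forall>x\<in>good. \<forall>s\<in>{0..t}. \<bar>outflow s x\<bar> \<le> C"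
    using outflow_locally_bounded by blast
  obtain H where H: "\<forall>t\<ge>0. \<forall>z\<in>offdiag K. \<bar>\<eta> t z\<bar> \<le> H" "H > 0"
    using \<eta>_bounded by blast
  have C\<alpha>: "0 \<le> C\<^sub>\<alpha>" using \<alpha>_bound[of 0] by linarith
  define A where "A = 2 * C\<^sub>\<alpha> * H"
  have "- r t x \<le> 0 * exp ((2 * A - A) * (t - 0))"
  proof (rule sup_gronwall[where I=good and u="\<lambda>x s. - r s x" and g="\<lambda>x s. outflow s x" and R=R and C=C and b=t])
    fix x s assume x: "x \<in> good" and s: "s \<in> {0..t}"
    show "((\<lambda>s. - r s x) has_real_derivative outflow s x) (at s within {0..t})"
      using DERIV_minus[OF r_has_derivative_within[OF x order_refl s]] by simp
    show "- r s x \<le> R" "\<bar>outflow s x\<bar> \<le> C"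
      using R C x s by (auto simp: abs_le_iff)
    fix P assume P: "0 \<le> P" "\<And>y. y \<in> good \<Longrightarrow> - r s y \<le> P"
    have "outflow s x \<le> (LINT y|\<mu>. A * r s x + 2 * A * P)"
    proof (rule outflow_le[where E="{0..H}"])
      fix y e assume y: "y \<in> good" and e: "e \<in> {0..H}"
      have "\<bar>\<alpha> (r s x) - \<alpha> (r s y)\<bar> * e \<le> 2 * C\<^sub>\<alpha> * H"
        using e \<alpha>_bound[of "r s x"] \<alpha>_bound[of "r s y"] C\<alpha> by (intro mult_mono) auto
      then show "Phi_upwind (r s x) (r s y) (\<alpha> (r s x) - \<alpha> (r s y)) * e \<le> A * r s x + 2 * A * P"
        using P(1) P(2)[OF x] P(2)[OF y] e unfolding A_def by (intro Phi_upwind_le_linear) auto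
    qed (use x s H \<eta>_nonneg in \<open>auto simp: abs_le_iff\<close>)
    then show "outflow s x + A * - r s x \<le> 2 * A * P"
      by (simp add: prob_space)
  qed (use t x r_0_nonneg C\<alpha> H in \<open>auto simp: A_def\<close>)
  then show ?thesis by simp
qed

text \<open>A maximum principle: since \<alpha> is monotone, the upwind flux brings mass to
  \<open>x\<close> only from points with larger values, and the inflow is at most a multiple of the
  distance from \<open>r s x\<close> to the current upper bound \<open>N + P\<close>.\<close>

lemma r_le_initial:
  assumes \<eta>_nonneg: "\<And>t z. 0 \<le> t \<Longrightarrow> z \<in> offdiag K \<Longrightarrow> 0 \<le> \<eta> t z"
    and mono: "\<And>a b. a \<le> b \<Longrightarrow> \<alpha> a \<le> \<alpha> b"
    and lip: "\<And>a b. a \<le> b \<Longrightarrow> \<alpha> b - \<alpha> a \<le> L * (b - a)" and "0 \<le> L"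
    and x: "x \<in> good" and t: "0 \<le> t"
  shows "r t x \<le> Linf_norm \<mu> (r 0)"
proof -
  obtain R where R: "\<forall>x\<in>good. \<forall>s\<in>{0..t}. \<bar>r s x\<bar> \<le> R" and "R \<ge> 0"
    using r_locally_bounded by blast
  obtain C where C: "\<forall>x\<in>good. \<forall>s\<in>{0..t}. \<bar>outflow s x\<bar> \<le> C"
    using outflow_locally_bounded by blast
  obtain H where H: "\<forall>t\<ge>0. \<forall>z\<in>offdiag K. \<bar>\<eta> t z\<bar> \<le> H" "H > 0"
    using \<eta>_bounded by blast
  define N where "N = Linf_norm \<mu> (r 0)"
  define B where "B = R * L * H"
  have "0 \<le> N"
    unfolding N_def by (intro Linf_norm_nonneg r_Linf) simp
  have "r t x - N \<le> 0 * exp ((B - B) * (t - 0))"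
  proof (rule sup_gronwall[where I=good and u="\<lambda>x s. r s x - N" and g="\<lambda>x s. - outflow s x" and R=R and C=C and b=t])
    fix x s assume x: "x \<in> good" and s: "s \<in> {0..t}"
    show "((\<lambda>s. r s x - N) has_real_derivative - outflow s x) (at s within {0..t})"
      using DERIV_diff[OF r_has_derivative_within[OF x order_refl s] DERIV_const[of N]] by simp
    show "\<bar>- outflow s x\<bar> \<le> C"
      using C x s by auto
    have "r s x \<le> R" using R x s by (auto simp: abs_le_iff)
    then show "r s x - N \<le> R" using \<open>0 \<le> N\<close> by simp
    fix P assume P: "0 \<le> P" "\<And>y. y \<in> good \<Longrightarrow> r s y - N \<le> P"
    have "- outflow s x \<le> (LINT y|\<mu>. B * (N + P - r s x))"
    proof (rule neg_outflow_le[where E="{0..H}"])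
      fix y e assume y: "y \<in> good" and e: "e \<in> {0..H}"
      \<comment> \<open>The zeros are the choices \<open>h = c = m = 0\<close> in
        \<open>neg_Phi_upwind_le\<close>, which leave only the inflow term.\<close>
      have "- (Phi_upwind (r s x) (r s y) (\<alpha> (r s x) - \<alpha> (r s y)) * e)
          \<le> R * L * H * (N + P - r s x) - 0 * 0 * 0 * (r s x - r s y)"
        using x y s e R P(1) P(2)[OF x] P(2)[OF y] \<open>0 \<le> L\<close> mono lip r_nonneg[OF \<eta>_nonneg]
        by (intro neg_Phi_upwind_le) (auto simp: abs_le_iff)
      then show "- (Phi_upwind (r s x) (r s y) (\<alpha> (r s x) - \<alpha> (r s y)) * e) \<le> B * (N + P - r s x)"
        by (simp add: B_def)
    qed (use x s H \<eta>_nonneg in \<open>auto simp: abs_le_iff\<close>)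
    then show "- outflow s x + B * (r s x - N) \<le> B * P"
      by (simp add: prob_space algebra_simps)
  next
    fix x assume "x \<in> good"
    then show "r 0 x - N \<le> 0"
      using r_le_norm[of x 0] by (simp add: N_def)
  qed (use t x \<open>R \<ge> 0\<close> \<open>0 \<le> L\<close> H in \<open>auto simp: B_def\<close>)
  then show ?thesis by (simp add: N_def)
qed

text \<open>In \<open>up\<close> and \<open>low\<close>, \<open>k\<close> stems from the flux that
  pulls a value towards the mean, through coercivity and the conserved mass, and \<open>B\<close>
  from the flux that pushes it away. The contributions of \<open>B\<close> cancel in the Gronwall
  exponent.\<close>

lemma r_tendsto_mean:
  assumes \<eta>_nonneg: "\<And>t z. 0 \<le> t \<Longrightarrow> z \<in> offdiag K \<Longrightarrow> 0 \<le> \<eta> t z"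
    and \<eta>_ge: "\<And>t z. 1 \<le> t \<Longrightarrow> z \<in> offdiag K \<Longrightarrow> h \<le> \<eta> t z" and "0 < h"
    and mono: "\<And>a b. a \<le> b \<Longrightarrow> \<alpha> a \<le> \<alpha> b"
    and lip: "\<And>a b. a \<le> b \<Longrightarrow> \<alpha> b - \<alpha> a \<le> L * (b - a)" and "0 \<le> L"
    and coercive: "\<And>a b. 0 \<le> a \<Longrightarrow> a \<le> b \<Longrightarrow> b \<le> Linf_norm \<mu> (r 0) \<Longrightarrow> c * (b - a) \<le> \<alpha> b - \<alpha> a"
    and "0 < c" and mass: "(LINT x|\<mu>. r 0 x) = M" and "0 < M"
    and x: "x \<in> good"
  shows "((\<lambda>t. r t x) \<longlongrightarrow> M) at_top"
proof -
  define R where "R = Linf_norm \<mu> (r 0)"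
  have "0 \<le> R"
    unfolding R_def by (intro Linf_norm_nonneg r_Linf) simp
  have r: "0 \<le> r s y" "r s y \<le> R" if "y \<in> good" "0 \<le> s" for s y
    using r_nonneg[OF \<eta>_nonneg that] r_le_initial[OF \<eta>_nonneg mono lip \<open>0 \<le> L\<close> that]
    by (auto simp: R_def)
  have int: "integrable \<mu> (r s)" "(LINT x|\<mu>. r s x) = M" if "0 \<le> s" for s
    using r_integrable mass_conserved mass that by auto
  obtain H0 where H0: "\<forall>t\<ge>0. \<forall>z\<in>offdiag K. \<bar>\<eta> t z\<bar> \<le> H0" "H0 > 0"
    using \<eta>_bounded by blast
  \<comment> \<open>The maximum with \<open>h\<close> keeps \<open>{h..H}\<close> nonempty even if
    there are no off-diagonal pairs.\<close>
  define H where "H = max H0 h"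
  have "0 < H" "h \<le> H" using H0 by (auto simp: H_def)
  have H: "\<eta> s z \<in> {h..H}" if "1 \<le> s" "z \<in> offdiag K" for s z
    using H0 that \<eta>_ge by (auto simp: H_def abs_le_iff le_max_iff_disj)
  define B where "B = R * L * H"
  define k where "k = h * c * M"
  have "0 < k" "0 \<le> B"
    using \<open>0 < h\<close> \<open>0 < c\<close> \<open>0 < M\<close> \<open>0 \<le> R\<close> \<open>0 \<le> L\<close> \<open>0 < H\<close> by (auto simp: k_def B_def)
  have up: "- outflow s x + (k + B) * (r s x - M) \<le> B * P"
    if x: "x \<in> good" and s: "1 \<le> s" and P: "0 \<le> P" "\<And>y. y \<in> good \<Longrightarrow> r s y - M \<le> P" for x s P
  proof -
    \<comment> \<open>Below the mean the outgoing flux is dropped: there the term \<open>k (r - M)\<close> is already negative.\<close>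
    define m where "m = (if M \<le> r s x then M else 0)"
    have m: "0 \<le> m" "m \<le> r s x" using \<open>0 < M\<close> r[OF x, of s] s by (auto simp: m_def)
    have "- outflow s x \<le> (LINT y|\<mu>. R * L * H * (M + P - r s x) - h * c * m * (r s x - r s y))"
    proof (rule neg_outflow_le[where E="{h..H}"])
      fix y e assume y: "y \<in> good" and e: "e \<in> {h..H}"
      show "- (Phi_upwind (r s x) (r s y) (\<alpha> (r s x) - \<alpha> (r s y)) * e)
          \<le> R * L * H * (M + P - r s x) - h * c * m * (r s x - r s y)"
        using r[OF x, of s] r[OF y, of s] s e P(1) P(2)[OF x] P(2)[OF y] \<open>0 \<le> L\<close> \<open>0 < h\<close> \<open>0 < c\<close>
          mono[of "r s x" "r s y"] lip[of "r s x" "r s y"] coercive[of "r s y" "r s x"] m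
        by (intro neg_Phi_upwind_le) (auto simp: R_def)
    qed (use x s H \<open>h \<le> H\<close> int(1)[of s] in auto)
    also have "\<dots> = B * (M + P - r s x) - h * c * m * (r s x - M)"
      using int[of s] s by (simp add: prob_space B_def)
    finally have "- outflow s x \<le> B * (M + P - r s x) - h * c * m * (r s x - M)" .
    moreover have "k * (r s x - M) \<le> h * c * m * (r s x - M)"
      using \<open>0 < k\<close> by (auto simp: m_def k_def mult_nonneg_nonpos)
    ultimately show ?thesis
      by (simp add: algebra_simps)
  qed
  have low: "outflow s x + (k + B) * (M - r s x) \<le> B * P"
    if x: "x \<in> good" and s: "1 \<le> s" and P: "0 \<le> P" "\<And>y. y \<in> good \<Longrightarrow> M - r s y \<le> P" for x s P
  proof -
    have "outflow s x \<le> (LINT y|\<mu>. R * L * H * (r s x - (M - P)) - h * c * ((2 * M - r s x) * r s y - M\<^sup>2))"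
    proof (rule outflow_le[where E="{h..H}"])
      fix y e assume y: "y \<in> good" and e: "e \<in> {h..H}"
      have "Phi_upwind (r s x) (r s y) (\<alpha> (r s x) - \<alpha> (r s y)) * e
          \<le> R * L * H * (r s x - (M - P)) - h * c * r s y * (r s y - r s x)"
        using r[OF x, of s] r[OF y, of s] s e P(1) P(2)[OF x] P(2)[OF y] \<open>0 \<le> L\<close> \<open>0 < h\<close> \<open>0 < c\<close>
          mono[of "r s y" "r s x"] lip[of "r s y" "r s x"] coercive[of "r s x" "r s y"]
        by (intro Phi_upwind_le) (auto simp: R_def)
      \<comment> \<open>The square of \<open>r s y\<close> is replaced by its tangent at
        \<open>M\<close>. The bound becomes affine in \<open>r s y\<close>, and its integral is
        exactly \<open>M * (M - r s x)\<close>.\<close>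
      moreover have "(2 * M - r s x) * r s y - M\<^sup>2 \<le> r s y * (r s y - r s x)"
        using zero_le_power2[of "r s y - M"] by (simp add: power2_eq_square algebra_simps)
      then have "h * c * ((2 * M - r s x) * r s y - M\<^sup>2) \<le> h * c * (r s y * (r s y - r s x))"
        using \<open>0 < h\<close> \<open>0 < c\<close> by (intro mult_left_mono) auto
      ultimately show "Phi_upwind (r s x) (r s y) (\<alpha> (r s x) - \<alpha> (r s y)) * e
          \<le> R * L * H * (r s x - (M - P)) - h * c * ((2 * M - r s x) * r s y - M\<^sup>2)"
        by (simp only: mult.assoc)
    qed (use x s H \<open>h \<le> H\<close> int(1)[of s] in auto)
    also have "\<dots> = B * (r s x - (M - P)) - k * (M - r s x)"
      using int[of s] s by (simp add: prob_space B_def k_def power2_eq_square algebra_simps)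
    finally show ?thesis
      by (simp add: algebra_simps)
  qed
  let ?u = "\<lambda>(x, \<sigma>) s. \<sigma> * (r s x - M)" and ?g = "\<lambda>(x, \<sigma>) s. - (\<sigma> * outflow s x)"
  have decay: "\<bar>r t x - M\<bar> \<le> (R + M) * exp (- k * (t - 1))" if t: "1 \<le> t" for t
  proof -
    obtain C where C: "\<forall>x\<in>good. \<forall>s\<in>{0..t}. \<bar>outflow s x\<bar> \<le> C"
      using outflow_locally_bounded by blast
    \<comment> \<open>The exponent \<open>B - (k + B)\<close> is the decay rate
      \<open>- k\<close>.\<close>
    have *: "?u i t \<le> (R + M) * exp ((B - (k + B)) * (t - 1))" if "i \<in> good \<times> {1, - 1}" for i
    proof (rule sup_gronwall[where I="good \<times> {1, - 1 :: real}" and g="?g" and R="R + M" and C=C and b=t])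
      fix i s assume "i \<in> good \<times> {1, - 1 :: real}" and s: "s \<in> {1..t}"
      then obtain x \<sigma> where i: "i = (x, \<sigma>)" "x \<in> good" "\<sigma> = 1 \<or> \<sigma> = - 1" by auto
      have "((\<lambda>s. r s x - M) has_real_derivative - outflow s x) (at s within {1..t})"
        using DERIV_diff[OF r_has_derivative_within[OF i(2) _ s] DERIV_const[of M]] by simp
      from DERIV_cmult[OF this, of \<sigma>] show "(?u i has_real_derivative ?g i s) (at s within {1..t})"
        by (simp add: i)
      show "?u i s \<le> R + M"
        using r[OF i(2), of s] s i(3) \<open>0 < M\<close> \<open>0 \<le> R\<close> by (auto simp: i(1))
      show "\<bar>?g i s\<bar> \<le> C"
        using C i s by force
      fix P assume "0 \<le> P" and P: "\<And>j. j \<in> good \<times> {1, - 1} \<Longrightarrow> ?u j s \<le> P"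
      have "r s y - M \<le> P" "M - r s y \<le> P" if "y \<in> good" for y
        using P[of "(y, 1)"] P[of "(y, - 1)"] that by auto
      with up[OF i(2), of s P] low[OF i(2), of s P] \<open>0 \<le> P\<close> s i(3)
      show "?g i s + (k + B) * ?u i s \<le> B * P"
        by (auto simp: i(1) algebra_simps)
    next
      fix i assume "i \<in> good \<times> {1, - 1 :: real}"
      then show "?u i 1 \<le> R + M"
        using r[of "fst i" 1] \<open>0 < M\<close> \<open>0 \<le> R\<close> by auto
    qed (use t that \<open>0 \<le> B\<close> \<open>0 < M\<close> \<open>0 \<le> R\<close> in auto)
    from *[of "(x, 1)"] *[of "(x, - 1)"] x show ?thesis
      by (auto simp: abs_le_iff)
  qed
  have "((\<lambda>t. (R + M) * exp (- k * (t - 1))) \<longlongrightarrow> 0) at_top"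
  proof -
    have "filterlim (\<lambda>t. - k * (t - 1)) at_bot at_top"
      using \<open>0 < k\<close> by real_asymp
    then show ?thesis
      by (intro tendsto_mult_right_zero) (rule filterlim_compose[OF exp_at_bot])
  qed
  then have "((\<lambda>t. r t x - M) \<longlongrightarrow> 0) at_top"
    by (rule Lim_null_comparison[rotated])
      (use decay in \<open>auto simp: eventually_at_top_linorder intro!: exI[of _ 1]\<close>)
  then show ?thesis
    using LIM_zero_iff by blast
qed

end

section \<open>From the hypotheses of the theorem to the two cases of zero and positive mass\<close>

theorem theorem5p6:
  fixes \<mu> :: "(real ^ 'd) measure" and K :: "(real ^ 'd) set"
    and V :: "real \<Rightarrow> (real ^ 'd \<Rightarrow> real) \<Rightarrow> (real ^ 'd) \<times> (real ^ 'd) \<Rightarrow> real"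
    and v :: "real \<Rightarrow> real \<Rightarrow> real \<Rightarrow> real"
    and \<alpha> :: "real \<Rightarrow> real"
    and \<omega> :: "real \<Rightarrow> (real ^ 'd \<Rightarrow> real) \<Rightarrow> (real ^ 'd) \<times> (real ^ 'd) \<Rightarrow> real"
    and r0 :: "real ^ 'd \<Rightarrow> real" and \<eta>0 :: "(real ^ 'd) \<times> (real ^ 'd) \<Rightarrow> real"
    and r :: "real \<Rightarrow> real ^ 'd \<Rightarrow> real"
    and \<eta> :: "real \<Rightarrow> (real ^ 'd) \<times> (real ^ 'd) \<Rightarrow> real"
    and C\<^sub>V L\<^sub>V L\<^sub>\<omega> C\<^sub>\<omega> M :: real
  assumes borel: "sets \<mu> = sets borel" and prob: "prob_space \<mu>"
    and K: "K = measure_supp \<mu>" "compact K"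
    and r_AC: "r \<in> AC (Linf_norm \<mu>) (Linf \<mu>)"
    and \<eta>_AC: "\<eta> \<in> AC (sup_norm_on (offdiag K)) (Cb (offdiag K))"
    and solution: "euler_co_ncl_solution \<mu> K Phi_upwind v \<omega> r0 \<eta>0 r \<eta>"
    and V: "velocity_field \<mu> K V" "time_continuous_velocity \<mu> K V"
      "pointwise_velocity \<mu> K V v" "monotonic_velocity \<mu> v"
    and V_form: "\<And>t a b. t \<ge> 0 \<Longrightarrow> v t a b = \<alpha> a - \<alpha> b"
    and \<alpha>: "\<alpha> \<in> C1b"
      "\<And>\<Omega>. compact \<Omega> \<Longrightarrow> \<exists>c>0. \<forall>a\<in>\<Omega>. deriv \<alpha> a > c"
    and V_const: "C\<^sub>V > 0" "L\<^sub>V > 0"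
    and V_bound: "\<And>t g. t \<ge> 0 \<Longrightarrow> g \<in> Linf \<mu> \<Longrightarrow>
      AE x in \<mu>. AE x' in \<mu>. (x, x') \<in> offdiag K \<longrightarrow> \<bar>v t (g x) (g x')\<bar> \<le> C\<^sub>V"
    and V_Lip: "\<And>t g h. t \<ge> 0 \<Longrightarrow> g \<in> Linf \<mu> \<Longrightarrow> h \<in> Linf \<mu> \<Longrightarrow>
      AE x in \<mu>. AE x' in \<mu>. (x, x') \<in> offdiag K \<longrightarrow>
        \<bar>v t (g x) (g x') - v t (h x) (h x')\<bar> \<le> L\<^sub>V * Linf_norm \<mu> (g - h)"
    and \<omega>_cont: "\<And>t g. t \<ge> 0 \<Longrightarrow> g \<in> Linf \<mu> \<Longrightarrow> continuous_on (offdiag K) (\<omega> t g)"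
    and \<omega>_sym: "\<And>t g. t \<ge> 0 \<Longrightarrow> g \<in> Linf \<mu> \<Longrightarrow> symmetric_on (offdiag K) (\<omega> t g)"
    and \<omega>_L1: "\<And>T g z. T > 0 \<Longrightarrow> g \<in> Linf \<mu> \<Longrightarrow> z \<in> offdiag K \<Longrightarrow>
      (\<lambda>t. \<omega> t g z) absolutely_integrable_on {0..T}"
    and \<omega>_const: "L\<^sub>\<omega> \<ge> 0" "C\<^sub>\<omega> > 0"
    and \<omega>_Lip: "\<And>t f g z. t \<ge> 0 \<Longrightarrow> f \<in> Linf \<mu> \<Longrightarrow> g \<in> Linf \<mu> \<Longrightarrow> z \<in> offdiag K \<Longrightarrow>
      \<bar>\<omega> t f z - \<omega> t g z\<bar> \<le> L\<^sub>\<omega> * Linf_norm \<mu> (f - g)"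
    and \<omega>_bound: "\<And>t f z. t \<ge> 0 \<Longrightarrow> f \<in> Linf \<mu> \<Longrightarrow> z \<in> offdiag K \<Longrightarrow> \<bar>\<omega> t f z\<bar> \<le> C\<^sub>\<omega>"
    and \<omega>_pos: "0 < (INF t\<in>{0..}. INF z\<in>offdiag K.
      INF g\<in>{g \<in> Linf \<mu>. \<not> (AE x in \<mu>. g x = 0)}. ereal (\<omega> t g z))"
    and r0_nonneg: "AE x in \<mu>. r0 x \<ge> 0"
    and r0_mass: "(LINT x:K|\<mu>. r0 x) = M"
    and \<eta>0_pos: "\<And>z. z \<in> offdiag K \<Longrightarrow> \<eta>0 z > 0"
    and \<eta>0_sym: "symmetric_on (offdiag K) \<eta>0"
  shows "AE x in \<mu>. ((\<lambda>t. r t x) \<longlongrightarrow> M / measure \<mu> K) at_top"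
proof -
  interpret prob_space \<mu> by (rule prob)
  have "bounded (range (deriv \<alpha>))" "bounded (range \<alpha>)" and diff: "\<And>a. \<alpha> differentiable at a"
    using \<alpha>(1) by (auto simp: C1b_def)
  then obtain L C\<^sub>\<alpha> where L: "\<And>a. \<bar>deriv \<alpha> a\<bar> \<le> L" and C\<^sub>\<alpha>: "\<And>a. \<bar>\<alpha> a\<bar> \<le> C\<^sub>\<alpha>"
    by (auto simp: bounded_iff)
  have deriv: "(\<alpha> has_real_derivative deriv \<alpha> a) (at a)" for a
    using diff[of a] by (simp add: DERIV_deriv_iff_real_differentiable)
  have mvt: "\<exists>\<xi>\<in>{a..b}. \<alpha> b - \<alpha> a = deriv \<alpha> \<xi> * (b - a)" if "a \<le> b" for a b
    using mvt_very_simple[OF that, of \<alpha> "\<lambda>x. (*) (deriv \<alpha> x)"] deriv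
    by (auto simp: has_field_derivative_def intro: has_derivative_at_withinI)
  have "0 \<le> L" using L[of 0] by linarith
  have lip: "\<alpha> b - \<alpha> a \<le> L * (b - a)" if "a \<le> b" for a b
    using mvt[OF that] L that by (auto simp: abs_le_iff intro!: mult_right_mono)
  \<comment> \<open>Singletons are compact, so the slope is positive everywhere, though not
    uniformly.\<close>
  have pos: "0 < deriv \<alpha> a" for a
    using \<alpha>(2)[of "{a}"] by auto
  have mono: "\<alpha> a \<le> \<alpha> b" if "a \<le> b" for a b
  proof -
    obtain \<xi> where "\<alpha> b - \<alpha> a = deriv \<alpha> \<xi> * (b - a)"
      using mvt[OF \<open>a \<le> b\<close>] by blast
    moreover have "0 \<le> deriv \<alpha> \<xi> * (b - a)"
      using pos[of \<xi>] that by simp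
    ultimately show ?thesis by simp
  qed
  \<comment> \<open>By nonnegativity and the maximum principle this interval contains all values of
    the solution at good points.\<close>
  obtain c where "c > 0" and c: "\<forall>x\<in>{0..Linf_norm \<mu> (r 0)}. deriv \<alpha> x > c"
    using \<alpha>(2)[of "{0..Linf_norm \<mu> (r 0)}"] by auto
  have coercive: "c * (b - a) \<le> \<alpha> b - \<alpha> a" if "0 \<le> a" "a \<le> b" "b \<le> Linf_norm \<mu> (r 0)" for a b
  proof -
    obtain \<xi> where \<xi>: "\<xi> \<in> {a..b}" "\<alpha> b - \<alpha> a = deriv \<alpha> \<xi> * (b - a)"
      using mvt[OF \<open>a \<le> b\<close>] by blast
    then have "c \<le> deriv \<alpha> \<xi>"
      using c that by (intro less_imp_le) auto
    then show ?thesis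
      unfolding \<xi>(2) using that by (intro mult_right_mono) auto
  qed
  have "isCont \<alpha> a" for a
    using deriv by (rule DERIV_isCont)
  then have \<alpha>_cont: "continuous_on UNIV \<alpha>"
    by (simp add: continuous_at_imp_continuous_on)
  have AE_K: "AE x in \<mu>. x \<in> K"
    unfolding K(1) by (rule AE_in_measure_supp[OF borel])
  have r_Linf: "r t \<in> Linf \<mu>" if "0 \<le> t" for t
    using r_AC that by (simp add: AC_def)
  interpret co_ncl \<mu> K \<alpha> v \<omega> r0 \<eta>0 r \<eta> C\<^sub>\<alpha> C\<^sub>\<omega>
  proof
    show "\<eta> t \<in> Cb (offdiag K)" if "0 \<le> t" for t
      using \<eta>_AC that by (simp add: AC_def)
  qed (use borel K AE_K r_AC solution V_form \<alpha>_cont C\<^sub>\<alpha> \<omega>_sym \<omega>_bound r_Linf r0_nonneg \<eta>0_sym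
      in \<open>auto intro: compact_imp_closed\<close>)
  have "K \<in> sets \<mu>"
    using K(2) borel by (simp add: borel_closed compact_imp_closed)
  \<comment> \<open>The support carries the whole probability, so the claimed limit is
    \<open>M\<close> itself.\<close>
  then have K1: "measure \<mu> K = 1"
    using AE_K by (simp add: prob_eq_1)
  have r0_measurable: "r0 \<in> borel_measurable \<mu>"
    using solution by (simp add: euler_co_ncl_solution_def Linf_def)
  have mass: "(LINT x|\<mu>. r 0 x) = M"
    unfolding r0_mass[symmetric] set_lebesgue_integral_def
  proof (rule integral_cong_AE)
    show "AE x in \<mu>. r 0 x = indicat_real K x *\<^sub>R r0 x"
      using AE_good by eventually_elim (simp add: r_0 good_in_K)
  qed (use r0_measurable \<open>K \<in> sets \<mu>\<close> in auto)
  have "0 \<le> M"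
    unfolding mass[symmetric] using AE_good
    by (intro integral_nonneg_AE) (auto elim!: eventually_mono intro: r_0_nonneg)
  have "((\<lambda>t. r t x) \<longlongrightarrow> M) at_top" if x: "x \<in> good" for x
  proof (cases "M = 0")
    case True
    have "eventually (\<lambda>t. r t x = M) at_top"
      using eventually_ge_at_top[of 0] by eventually_elim (use r_zero[OF _ x] mass True in simp)
    then show ?thesis
      by (rule tendsto_eventually)
  next
    case False
    with \<open>0 \<le> M\<close> have "0 < M" by simp
    \<comment> \<open>The infimum is an extended real and is infinite if there are no off-diagonal
      pairs; a real number below it is chosen.\<close>
    obtain h where "0 < ereal h" and h: "ereal h < (INF t\<in>{0..}. INF z\<in>offdiag K.
        INF g\<in>{g \<in> Linf \<mu>. \<not> (AE x in \<mu>. g x = 0)}. ereal (\<omega> t g z))"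
      using ereal_dense2[OF \<omega>_pos] by auto
    have \<omega>_ge: "2 * (h / 2) \<le> \<omega> t (r t) z" if t: "0 \<le> t" and z: "z \<in> offdiag K" for t z
    proof -
      \<comment> \<open>The infimum runs over the nonzero classes only, and conservation of the mass
        keeps \<open>r t\<close> among them.\<close>
      have "\<not> (AE x in \<mu>. r t x = 0)"
      proof
        assume "AE x in \<mu>. r t x = 0"
        then have "(LINT x|\<mu>. r t x) = 0"
          by (rule integral_eq_zero_AE)
        then show False
          using mass_conserved[OF t] mass False by simp
      qed
      then have "ereal h < ereal (\<omega> t (r t) z)"
        using less_INF_D[OF less_INF_D[OF less_INF_D[OF h, of t], of z], of "r t"] t z r_Linf by auto
      then show ?thesis by simp
    qed
    have "0 < h" using \<open>0 < ereal h\<close> by simp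
    have \<eta>_ge: "h / 2 * min t 1 \<le> \<eta> t z" if "0 \<le> t" "z \<in> offdiag K" for t z
      using \<eta>_lower_bound[of "h / 2", OF _ \<omega>_ge _ that(2,1)] \<eta>0_pos \<open>0 < h\<close> by (auto intro: less_imp_le)
    show ?thesis
    proof (rule r_tendsto_mean[OF _ _ _ mono lip \<open>0 \<le> L\<close> coercive \<open>0 < c\<close> mass \<open>0 < M\<close> x])
      show "0 \<le> \<eta> t z" if "0 \<le> t" "z \<in> offdiag K" for t z
      proof -
        have "0 \<le> h / 2 * min t 1"
          using that \<open>0 < h\<close> by simp
        then show ?thesis
          using \<eta>_ge[OF that] by linarith
      qed
      show "h / 2 \<le> \<eta> t z" if "1 \<le> t" "z \<in> offdiag K" for t z
        using \<eta>_ge[of t z] that by simp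
    qed (use \<open>0 < h\<close> in auto)
  qed
  then show ?thesis
    unfolding K1 using AE_good by (auto elim: eventually_mono)
qed

end
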